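(* The functor $h_{\mathbb{P}}:\mathbb{L}\to\widehat{\mathbb{P}}$, $X\mapsto \mathbb{L}(-,X)|_{\mathbb{P}^{\mathrm{op}}}$, is fully faithful and preserves limits as well as subobjects. Moreover, $h_{\mathbb{P}}(X)$ is a sheaf for the open-dicover topology $\tau$ on $\mathbb{P}$, for all $X\in\mathbb{L}$.
   Context: An epo-space is a pair $(U,\preccurlyeq)$ where $U$ is a topological space homeomorphic to an open subset of $\mathbb{H}^n=\{(x_1,\dots,x_n)\in\mathbb{R}^n \mid x_n\geq 0\}$ for some $n\in\mathbb{N}$ and $\preccurlyeq\,\subseteq U\times U$ is a partial order on $U$ which is closed in the product topology. A chart on a topological space $X$ is an open subset $U\subseteq X$ which is (equipped with the structure of) an epo-space. Two charts $U,U'$ are compatible if their orders agree on $U\cap U'$. An atlas on $X$ is an open covering $(U_i)_{i\in I}$ of $X$ by pairwise compatible charts. A local epo-space $(X,(U_i))$ is a topological space $X$ with an atlas $(U_i)$. A dimap $f:(X,(U_i))\to(Y,(V_j))$ is a continuous map $f:X\to Y$ such that each restriction $f^{-1}(V_j)\cap U_i\to V_j$ is non-decreasing. $\mathbb{L}$ is the category of local epo-spaces and dimaps. An epo-space is regarded as a local epo-space with a one-chart atlas; $\mathbb{P}$ is the category of epo-spaces and dimaps (continuous non-decreasing maps), a full subcategory of $\mathbb{L}$. The open-dicover topology $\tau$ on $\mathbb{P}$ is the Grothendieck topology with basis: the covering families of $X\in\mathbb{P}$ are the families $(X_i)_{i\in I}$ of open subsets $X_i\subseteq X$ (with the order inherited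 from $X$) with $\bigcup_{i\in I}X_i=X$. $\widehat{\mathbb{P}}$ is the category of presheaves of sets on $\mathbb{P}$. On morphisms $h_{\mathbb{P}}$ sends $f:X\to Y$ to postcomposition $f\circ(-)$. Preserving subobjects means sending monomorphisms to monomorphisms.
   Formalization: Restrictions f^{-1}(V_j)∩U_i→V_j of dimaps need only be non-decreasing near each point, so morphisms of P are continuous locally non-decreasing maps; with globally non-decreasing restrictions dimaps do not compose and the sheaf claim fails. *)

theory Defs
  imports "HOL-Analysis.Analysis"
begin

section \<open>Categories\<close>

record ('o, 'm) cat =
  Obj :: "'o set"
  Arr :: "'m set"
  Dom :: "'m \<Rightarrow> 'o"
  Cod :: "'m \<Rightarrow> 'o"
  Ident :: "'o \<Rightarrow> 'm"
  Comp :: "'m \<Rightarrow> 'm \<Rightarrow> 'm"  \<comment> \<open>\<open>Comp C g f\<close> is \<open>g\<close> after \<open>f\<close>\<close>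

definition Hom :: "('o, 'm) cat \<Rightarrow> 'o \<Rightarrow> 'o \<Rightarrow> 'm set" where
  "Hom C X Y = {f \<in> Arr C. Dom C f = X \<and> Cod C f = Y}"

definition category :: "('o, 'm) cat \<Rightarrow> bool" where
  "category C \<longleftrightarrow>
     (\<forall>f\<in>Arr C. Dom C f \<in> Obj C \<and> Cod C f \<in> Obj C) \<and>
     (\<forall>X\<in>Obj C. Ident C X \<in> Hom C X X) \<and>
     (\<forall>f\<in>Arr C. \<forall>g\<in>Arr C. Cod C f = Dom C g \<longrightarrow>
        Comp C g f \<in> Hom C (Dom C f) (Cod C g)) \<and>
     (\<forall>f\<in>Arr C. Comp C f (Ident C (Dom C f)) = f \<and> Comp C (Ident C (Cod C f)) f = f) \<and>
     (\<forall>f\<in>Arr C. \<forall>g\<in>Arr C. \<forall>h\<in>Arr C. Cod C f = Dom C g \<longrightarrow> Cod C g = Dom C h \<longrightarrow>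
        Comp C h (Comp C g f) = Comp C (Comp C h g) f)"

definition opposite :: "('o, 'm) cat \<Rightarrow> ('o, 'm) cat" where
  "opposite C = \<lparr>Obj = Obj C, Arr = Arr C, Dom = Cod C, Cod = Dom C,
     Ident = Ident C, Comp = (\<lambda>g f. Comp C f g)\<rparr>"

definition full_subcategory :: "('o, 'm) cat \<Rightarrow> 'o set \<Rightarrow> ('o, 'm) cat" where
  "full_subcategory C S = \<lparr>Obj = Obj C \<inter> S,
     Arr = {f \<in> Arr C. Dom C f \<in> S \<and> Cod C f \<in> S},
     Dom = Dom C, Cod = Cod C, Ident = Ident C, Comp = Comp C\<rparr>"

definition monomorphism :: "('o, 'm) cat \<Rightarrow> 'm \<Rightarrow> bool" where
  "monomorphism C f \<longleftrightarrow> f \<in> Arr C \<and>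
     (\<forall>g\<in>Arr C. \<forall>h\<in>Arr C. Cod C g = Dom C f \<longrightarrow> Cod C h = Dom C f \<longrightarrow> Dom C g = Dom C h \<longrightarrow>
        Comp C f g = Comp C f h \<longrightarrow> g = h)"

datatype ('o1, 'm1, 'o2, 'm2) funct = Funct (on_obj: "'o1 \<Rightarrow> 'o2") (on_arr: "'m1 \<Rightarrow> 'm2")

definition is_functor ::
    "('o1, 'm1) cat \<Rightarrow> ('o2, 'm2) cat \<Rightarrow> ('o1, 'm1, 'o2, 'm2) funct \<Rightarrow> bool" where
  "is_functor C D F \<longleftrightarrow> category C \<and> category D \<and>
     (\<forall>X\<in>Obj C. on_obj F X \<in> Obj D) \<and>
     (\<forall>f\<in>Arr C. on_arr F f \<in> Hom D (on_obj F (Dom C f)) (on_obj F (Cod C f))) \<and>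
     (\<forall>X\<in>Obj C. on_arr F (Ident C X) = Ident D (on_obj F X)) \<and>
     (\<forall>f\<in>Arr C. \<forall>g\<in>Arr C. Cod C f = Dom C g \<longrightarrow>
        on_arr F (Comp C g f) = Comp D (on_arr F g) (on_arr F f))"

definition comp_functor ::
    "('o2, 'm2, 'o3, 'm3) funct \<Rightarrow> ('o1, 'm1, 'o2, 'm2) funct \<Rightarrow> ('o1, 'm1, 'o3, 'm3) funct" where
  "comp_functor G F = Funct (on_obj G \<circ> on_obj F) (on_arr G \<circ> on_arr F)"

definition fully_faithful ::
    "('o1, 'm1) cat \<Rightarrow> ('o2, 'm2) cat \<Rightarrow> ('o1, 'm1, 'o2, 'm2) funct \<Rightarrow> bool" where
  "fully_faithful C D F \<longleftrightarrow> is_functor C D F \<and>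
     (\<forall>X\<in>Obj C. \<forall>Y\<in>Obj C.
        bij_betw (on_arr F) (Hom C X Y) (Hom D (on_obj F X) (on_obj F Y)))"

definition preserves_monos ::
    "('o1, 'm1) cat \<Rightarrow> ('o2, 'm2) cat \<Rightarrow> ('o1, 'm1, 'o2, 'm2) funct \<Rightarrow> bool" where
  "preserves_monos C D F \<longleftrightarrow> (\<forall>f. monomorphism C f \<longrightarrow> monomorphism D (on_arr F f))"

definition is_cone ::
    "('j, 'k) cat \<Rightarrow> ('o, 'm) cat \<Rightarrow> ('j, 'k, 'o, 'm) funct \<Rightarrow> 'o \<Rightarrow> ('j \<Rightarrow> 'm) \<Rightarrow> bool" where
  "is_cone J C D A p \<longleftrightarrow> A \<in> Obj C \<and>
     (\<forall>j\<in>Obj J. p j \<in> Hom C A (on_obj D j)) \<and>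
     (\<forall>k\<in>Arr J. Comp C (on_arr D k) (p (Dom J k)) = p (Cod J k))"

definition is_limit ::
    "('j, 'k) cat \<Rightarrow> ('o, 'm) cat \<Rightarrow> ('j, 'k, 'o, 'm) funct \<Rightarrow> 'o \<Rightarrow> ('j \<Rightarrow> 'm) \<Rightarrow> bool" where
  "is_limit J C D A p \<longleftrightarrow> is_cone J C D A p \<and>
     (\<forall>B q. is_cone J C D B q \<longrightarrow>
        (\<exists>!u. u \<in> Hom C B A \<and> (\<forall>j\<in>Obj J. Comp C (p j) u = q j)))"

definition preserves_limits ::
    "('j, 'k) cat \<Rightarrow> ('o1, 'm1) cat \<Rightarrow> ('o2, 'm2) cat \<Rightarrow> ('o1, 'm1, 'o2, 'm2) funct \<Rightarrow> bool" where
  "preserves_limits J C D F \<longleftrightarrow>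
     (\<forall>G A p. is_functor J C G \<longrightarrow> is_limit J C G A p \<longrightarrow>
        is_limit J D (comp_functor F G) (on_obj F A) (on_arr F \<circ> p))"

text \<open>Arrows that carry their domain and codomain. Underlying functions are kept extensional
  throughout, so that equality of arrows is equality of maps.\<close>

datatype ('o, 'f) arrow = Arrow (src: 'o) (fn: 'f) (tgt: 'o)

text \<open>The category of all sets of elements of the type \<open>'v\<close>, which plays the role of a
  universe.\<close>

definition SetCat :: "('v set, ('v set, 'v \<Rightarrow> 'v) arrow) cat" where
  "SetCat = \<lparr>Obj = UNIV,
     Arr = {a. fn a \<in> src a \<rightarrow>\<^sub>E tgt a},
     Dom = src, Cod = tgt,
     Ident = (\<lambda>A. Arrow A (\<lambda>x\<in>A. x) A),
     Comp = (\<lambda>b a. Arrow (src a) (compose (src a) (fn b) (fn a)) (tgt b))\<rparr>"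

definition natural_transformation ::
    "('o1, 'm1) cat \<Rightarrow> ('o2, 'm2) cat \<Rightarrow> ('o1, 'm1, 'o2, 'm2) funct \<Rightarrow>
     ('o1, 'm1, 'o2, 'm2) funct \<Rightarrow> ('o1 \<Rightarrow> 'm2) \<Rightarrow> bool" where
  "natural_transformation C D F G \<eta> \<longleftrightarrow>
     (\<forall>X\<in>Obj C. \<eta> X \<in> Hom D (on_obj F X) (on_obj G X)) \<and>
     (\<forall>f\<in>Arr C. Comp D (\<eta> (Cod C f)) (on_arr F f) = Comp D (on_arr G f) (\<eta> (Dom C f)))"

definition functor_objects ::
    "('o1, 'm1) cat \<Rightarrow> ('o2, 'm2) cat \<Rightarrow> ('o1, 'm1, 'o2, 'm2) funct set" where
  "functor_objects C D =
     {F. is_functor C D F \<and> on_obj F \<in> extensional (Obj C) \<and> on_arr F \<in> extensional (Arr C)}"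

definition functor_category ::
    "('o1, 'm1) cat \<Rightarrow> ('o2, 'm2) cat \<Rightarrow>
     (('o1, 'm1, 'o2, 'm2) funct, (('o1, 'm1, 'o2, 'm2) funct, 'o1 \<Rightarrow> 'm2) arrow) cat" where
  "functor_category C D = \<lparr>Obj = functor_objects C D,
     Arr = {a. src a \<in> functor_objects C D \<and> tgt a \<in> functor_objects C D \<and>
               natural_transformation C D (src a) (tgt a) (fn a) \<and> fn a \<in> extensional (Obj C)},
     Dom = src, Cod = tgt,
     Ident = (\<lambda>F. Arrow F (\<lambda>X\<in>Obj C. Ident D (on_obj F X)) F),
     Comp = (\<lambda>b a. Arrow (src a) (\<lambda>X\<in>Obj C. Comp D (fn b X) (fn a X)) (tgt b))\<rparr>"

type_synonym ('o, 'm, 'v) presheaf = "('o, 'm, 'v set, ('v set, 'v \<Rightarrow> 'v) arrow) funct"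

definition Psh :: "('o, 'm) cat \<Rightarrow>
    (('o, 'm, 'v) presheaf, (('o, 'm, 'v) presheaf, 'o \<Rightarrow> ('v set, 'v \<Rightarrow> 'v) arrow) arrow) cat" where
  "Psh C = functor_category (opposite C) SetCat"

text \<open>For a full subcategory \<open>P\<close> of \<open>C\<close>, the functor \<open>X \<mapsto> C(-, X)|P\<^sup>o\<^sup>p\<close>, acting on arrows by
  postcomposition. The parameter \<open>\<phi>\<close>, to be injective on the arrows of \<open>C\<close>, only serves to view the
  hom-sets of \<open>C\<close> as objects of \<^const>\<open>SetCat\<close>.\<close>

definition hom_presheaf ::
    "('o, 'm) cat \<Rightarrow> ('o, 'm) cat \<Rightarrow> ('m \<Rightarrow> 'v) \<Rightarrow> 'o \<Rightarrow> ('o, 'm, 'v) presheaf" where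
  "hom_presheaf C P \<phi> X = Funct
     (\<lambda>U\<in>Obj P. \<phi> ` Hom C U X)
     (\<lambda>g\<in>Arr P. Arrow (\<phi> ` Hom C (Cod C g) X)
        (\<lambda>v\<in>\<phi> ` Hom C (Cod C g) X. \<phi> (Comp C (inv_into (Arr C) \<phi> v) g))
        (\<phi> ` Hom C (Dom C g) X))"

definition restricted_yoneda ::
    "('o, 'm) cat \<Rightarrow> ('o, 'm) cat \<Rightarrow> ('m \<Rightarrow> 'v) \<Rightarrow>
     ('o, 'm, ('o, 'm, 'v) presheaf, (('o, 'm, 'v) presheaf, 'o \<Rightarrow> ('v set, 'v \<Rightarrow> 'v) arrow) arrow) funct"
  where
  "restricted_yoneda C P \<phi> = Funct
     (hom_presheaf C P \<phi>)
     (\<lambda>f. Arrow (hom_presheaf C P \<phi> (Dom C f))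
        (\<lambda>U\<in>Obj P. Arrow (\<phi> ` Hom C U (Dom C f))
           (\<lambda>v\<in>\<phi> ` Hom C U (Dom C f). \<phi> (Comp C f (inv_into (Arr C) \<phi> v)))
           (\<phi> ` Hom C U (Cod C f)))
        (hom_presheaf C P \<phi> (Cod C f)))"

section \<open>Grothendieck topologies and sheaves\<close>

definition sieve :: "('o, 'm) cat \<Rightarrow> 'o \<Rightarrow> 'm set \<Rightarrow> bool" where
  "sieve C X S \<longleftrightarrow> S \<subseteq> {f \<in> Arr C. Cod C f = X} \<and>
     (\<forall>f\<in>S. \<forall>g\<in>Arr C. Cod C g = Dom C f \<longrightarrow> Comp C f g \<in> S)"

text \<open>The topology with basis \<open>K\<close>: a sieve covers iff it contains a covering family of \<open>K\<close>.\<close>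

definition topology_of_basis ::
    "('o, 'm) cat \<Rightarrow> ('o \<Rightarrow> 'm set set) \<Rightarrow> 'o \<Rightarrow> 'm set set" where
  "topology_of_basis C K X = {S. sieve C X S \<and> (\<exists>R\<in>K X. R \<subseteq> S)}"

definition matching_family ::
    "('o, 'm) cat \<Rightarrow> ('o, 'm, 'v) presheaf \<Rightarrow> 'm set \<Rightarrow> ('m \<Rightarrow> 'v) \<Rightarrow> bool" where
  "matching_family C F S s \<longleftrightarrow>
     (\<forall>f\<in>S. s f \<in> on_obj F (Dom C f)) \<and>
     (\<forall>f\<in>S. \<forall>g\<in>Arr C. Cod C g = Dom C f \<longrightarrow> fn (on_arr F g) (s f) = s (Comp C f g))"

definition is_sheaf ::
    "('o, 'm) cat \<Rightarrow> ('o \<Rightarrow> 'm set set) \<Rightarrow> ('o, 'm, 'v) presheaf \<Rightarrow> bool" where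
  "is_sheaf C \<tau> F \<longleftrightarrow> F \<in> Obj (Psh C) \<and>
     (\<forall>X\<in>Obj C. \<forall>S\<in>\<tau> X. \<forall>s. matching_family C F S s \<longrightarrow>
        (\<exists>!t. t \<in> on_obj F X \<and> (\<forall>f\<in>S. fn (on_arr F f) t = s f)))"

section \<open>Epo-spaces and local epo-spaces\<close>

text \<open>Coordinates are numbered from 0, so the last one is \<open>x (n - 1)\<close>. For \<open>n = 0\<close> the condition
  is vacuous and the space is a point.\<close>

definition half_space :: "nat \<Rightarrow> (nat \<Rightarrow> real) topology" where
  "half_space n = subtopology (Euclidean_space n) {x. x (n - 1) \<ge> 0}"

definition epo_space :: "'a topology \<Rightarrow> ('a \<times> 'a) set \<Rightarrow> bool" where
  "epo_space T R \<longleftrightarrow>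
     (\<exists>n W. openin (half_space n) W \<and> T homeomorphic_space subtopology (half_space n) W) \<and>
     R \<subseteq> topspace T \<times> topspace T \<and> partial_order_on (topspace T) R \<and>
     closedin (prod_topology T T) R"

text \<open>A chart is a pair of an open set and an order on it.\<close>

datatype 'a local_epo = LocalEpo (space_of: "'a topology") (atlas: "('a set \<times> ('a \<times> 'a) set) set")

definition is_chart :: "'a topology \<Rightarrow> 'a set \<times> ('a \<times> 'a) set \<Rightarrow> bool" where
  "is_chart T c \<longleftrightarrow> openin T (fst c) \<and> epo_space (subtopology T (fst c)) (snd c)"

definition restrict_order :: "('a \<times> 'a) set \<Rightarrow> 'a set \<Rightarrow> ('a \<times> 'a) set" where
  "restrict_order R A = R \<inter> (A \<times> A)"

definition compatible_charts :: "'a set \<times> ('a \<times> 'a) set \<Rightarrow> 'a set \<times> ('a \<times> 'a) set \<Rightarrow> bool" where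
  "compatible_charts c d \<longleftrightarrow>
     restrict_order (snd c) (fst c \<inter> fst d) = restrict_order (snd d) (fst c \<inter> fst d)"

definition local_epo_space :: "'a local_epo \<Rightarrow> bool" where
  "local_epo_space X \<longleftrightarrow>
     (\<forall>c\<in>atlas X. is_chart (space_of X) c) \<and>
     (\<Union>c\<in>atlas X. fst c) = topspace (space_of X) \<and>
     (\<forall>c\<in>atlas X. \<forall>d\<in>atlas X. compatible_charts c d)"

definition of_epo :: "'a topology \<Rightarrow> ('a \<times> 'a) set \<Rightarrow> 'a local_epo" where
  "of_epo T R = LocalEpo T {(topspace T, R)}"

definition locally_nondecreasing ::
    "'a topology \<Rightarrow> ('a \<times> 'a) set \<Rightarrow> ('b \<times> 'b) set \<Rightarrow> ('a \<Rightarrow> 'b) \<Rightarrow> bool" where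
  "locally_nondecreasing T R S f \<longleftrightarrow>
     (\<forall>x\<in>topspace T. \<exists>N. openin T N \<and> x \<in> N \<and>
        monotone_on N (\<lambda>a b. (a, b) \<in> R) (\<lambda>a b. (a, b) \<in> S) f)"

text \<open>The restrictions \<open>f\<^sup>-\<^sup>1(V) \<inter> U \<rightarrow> V\<close> are required to be non-decreasing locally, that is, near
  every point. With monotonicity on all of \<open>f\<^sup>-\<^sup>1(V) \<inter> U\<close> instead, dimaps would neither compose nor
  glue. Let \<open>A\<close> be the interval \<open>(0,1)\<close> with the order \<open>{(x, x)} \<union> {(1/4, 3/4)}\<close>, let \<open>Y\<close> be \<open>(0,1)\<close>
  with the charts \<open>(0, 2/3)\<close> and \<open>(1/3, 1)\<close>, both trivially ordered, and let \<open>Z\<close> be \<open>(0,1)\<close> as one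
  trivially ordered chart. The identity is chartwise monotone \<open>A \<rightarrow> Y\<close> and \<open>Y \<rightarrow> Z\<close> but not
  \<open>A \<rightarrow> Z\<close>; and its restrictions to the open subsets \<open>(0, 2/3)\<close> and \<open>(1/3, 1)\<close> of \<open>A\<close> are
  monotone maps to \<open>Z\<close>.\<close>

definition dimap :: "'a local_epo \<Rightarrow> 'b local_epo \<Rightarrow> ('a \<Rightarrow> 'b) \<Rightarrow> bool" where
  "dimap X Y f \<longleftrightarrow> continuous_map (space_of X) (space_of Y) f \<and>
     (\<forall>(U, R)\<in>atlas X. \<forall>(V, S)\<in>atlas Y.
        locally_nondecreasing (subtopology (space_of X) (f -` V \<inter> U)) R S f)"

type_synonym 'a dimap_arrow = "('a local_epo, 'a \<Rightarrow> 'a) arrow"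

text \<open>The local epo-spaces whose points are elements of the type \<open>'a\<close>, which plays the role of a
  universe.\<close>

definition LEpo :: "('a local_epo, 'a dimap_arrow) cat" where
  "LEpo = \<lparr>Obj = {X. local_epo_space X},
     Arr = {a. local_epo_space (src a) \<and> local_epo_space (tgt a) \<and>
               dimap (src a) (tgt a) (fn a) \<and> fn a \<in> extensional (topspace (space_of (src a)))},
     Dom = src, Cod = tgt,
     Ident = (\<lambda>X. Arrow X (\<lambda>x\<in>topspace (space_of X). x) X),
     Comp = (\<lambda>b a. Arrow (src a) (compose (topspace (space_of (src a))) (fn b) (fn a)) (tgt b))\<rparr>"

definition Epo :: "('a local_epo, 'a dimap_arrow) cat" where
  "Epo = full_subcategory LEpo {X. \<exists>T R. epo_space T R \<and> X = of_epo T R}"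

definition open_sub :: "'a topology \<Rightarrow> ('a \<times> 'a) set \<Rightarrow> 'a set \<Rightarrow> 'a local_epo" where
  "open_sub T R W = of_epo (subtopology T W) (restrict_order R W)"

definition open_dicovers :: "'a local_epo \<Rightarrow> 'a dimap_arrow set set" where
  "open_dicovers X = {K. \<exists>T R \<U>. X = of_epo T R \<and> (\<forall>W\<in>\<U>. openin T W) \<and> \<Union>\<U> = topspace T \<and>
     K = (\<lambda>W. Arrow (open_sub T R W) (\<lambda>x\<in>W. x) X) ` \<U>}"

definition open_dicover_topology :: "'a local_epo \<Rightarrow> 'a dimap_arrow set set" where
  "open_dicover_topology = topology_of_basis Epo open_dicovers"

end

theory Submission
  imports Defs
begin

text \<open>For any full subcategory \<open>P\<close> of \<open>C\<close> the functor \<open>X \<mapsto> C(-, X)|P\<^sup>o\<^sup>p\<close> preserves limits and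
  monomorphisms, because these can be tested on elements \<open>U \<rightarrow> X\<close>. The geometry enters through two
  facts: the one-point epo-space represents the set of points, so that a natural transformation
  \<open>h X \<rightarrow> h Y\<close> and a matching family for \<open>h Y\<close> each determine a map of points; and being a dimap is
  local on the source, so that this map is a dimap as soon as it is one on the charts of \<open>X\<close>,
  respectively on the members of the open cover.\<close>

section \<open>Categories\<close>

text \<open>Points suffice because an arrow of \<open>LEpo\<close> is determined by its extensional
  underlying function, and evaluating that function at a point is precomposition with an arrow out
  of the one-point space. Naturality, or the matching condition, along the points of a test object
  \<open>U\<close> therefore forces the underlying function of the value at \<open>U\<close>: it
  must be the one map of points followed after the given arrow into \<open>X\<close>. Agreement on
  overlaps of charts or of cover members is thereby built in, and only the dimap property of this
  one map is left. There the local form of monotonicity is decisive. A related pair in a large open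
  set need not be carried into a single chart of the target, but near each point it is; composition
  and gluing both live on this. The other obstacle is one of types: hom-sets consist of arrows,
  while presheaves take values in sets over \<open>'v\<close>. Elements of a presheaf
  \<open>h X\<close> are thus codes \<open>\<phi> k\<close> of arrows \<open>k\<close>, and arrows
  of presheaves are built and compared element by element, decoding at each step.\<close>

lemma in_Hom_iff: "f \<in> Hom C X Y \<longleftrightarrow> f \<in> Arr C \<and> Dom C f = X \<and> Cod C f = Y"
  by (simp add: Hom_def)

lemma categoryI:
  assumes "\<And>f. f \<in> Arr C \<Longrightarrow> Dom C f \<in> Obj C" "\<And>f. f \<in> Arr C \<Longrightarrow> Cod C f \<in> Obj C"
    and "\<And>X. X \<in> Obj C \<Longrightarrow> Ident C X \<in> Hom C X X"
    and "\<And>X Y Z f g. f \<in> Hom C X Y \<Longrightarrow> g \<in> Hom C Y Z \<Longrightarrow> Comp C g f \<in> Hom C X Z"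
    and "\<And>X Y f. f \<in> Hom C X Y \<Longrightarrow> Comp C f (Ident C X) = f"
    and "\<And>X Y f. f \<in> Hom C X Y \<Longrightarrow> Comp C (Ident C Y) f = f"
    and "\<And>X Y Z W f g h. f \<in> Hom C X Y \<Longrightarrow> g \<in> Hom C Y Z \<Longrightarrow> h \<in> Hom C Z W \<Longrightarrow>
           Comp C h (Comp C g f) = Comp C (Comp C h g) f"
  shows "category C"
  unfolding category_def using assms by (simp add: in_Hom_iff)

lemma Hom_Obj:
  assumes "category C" "f \<in> Hom C X Y"
  shows "X \<in> Obj C" "Y \<in> Obj C"
  using assms by (auto simp: category_def in_Hom_iff)

lemma Ident_in_Hom: "category C \<Longrightarrow> X \<in> Obj C \<Longrightarrow> Ident C X \<in> Hom C X X"
  by (simp add: category_def)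

lemma Comp_in_Hom:
  "category C \<Longrightarrow> f \<in> Hom C X Y \<Longrightarrow> g \<in> Hom C Y Z \<Longrightarrow> Comp C g f \<in> Hom C X Z"
  by (auto simp: category_def in_Hom_iff)

lemma Comp_Ident_right: "category C \<Longrightarrow> f \<in> Hom C X Y \<Longrightarrow> Comp C f (Ident C X) = f"
  by (auto simp: category_def in_Hom_iff)

lemma Comp_Ident_left: "category C \<Longrightarrow> f \<in> Hom C X Y \<Longrightarrow> Comp C (Ident C Y) f = f"
  by (auto simp: category_def in_Hom_iff)

lemma Comp_assoc:
  assumes "category C" "f \<in> Hom C X Y" "g \<in> Hom C Y Z" "h \<in> Hom C Z W"
  shows "Comp C h (Comp C g f) = Comp C (Comp C h g) f"
proof -
  have "\<forall>f\<in>Arr C. \<forall>g\<in>Arr C. \<forall>h\<in>Arr C. Cod C f = Dom C g \<longrightarrow> Cod C g = Dom C h \<longrightarrow>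
      Comp C h (Comp C g f) = Comp C (Comp C h g) f"
    using assms(1) unfolding category_def by (elim conjE)
  then show ?thesis
    using assms(2-4) by (simp add: in_Hom_iff)
qed

lemma opposite_simps [simp]:
  "Obj (opposite C) = Obj C" "Arr (opposite C) = Arr C"
  "Dom (opposite C) = Cod C" "Cod (opposite C) = Dom C"
  "Ident (opposite C) = Ident C" "Comp (opposite C) g f = Comp C f g"
  by (simp_all add: opposite_def)

lemma Hom_opposite [simp]: "Hom (opposite C) X Y = Hom C Y X"
  by (auto simp: in_Hom_iff)

lemma category_opposite:
  assumes "category C"
  shows "category (opposite C)"
proof (rule categoryI)
  fix X Y Z W f g k
  assume "f \<in> Hom (opposite C) X Y" "g \<in> Hom (opposite C) Y Z" "k \<in> Hom (opposite C) Z W"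
  then show "Comp (opposite C) k (Comp (opposite C) g f) =
      Comp (opposite C) (Comp (opposite C) k g) f"
    using Comp_assoc[OF assms, of k W Z g Y f X] by simp
next
  fix f assume "f \<in> Arr (opposite C)"
  then have "f \<in> Hom C (Dom C f) (Cod C f)" by (simp add: in_Hom_iff)
  from Hom_Obj[OF assms this]
  show "Dom (opposite C) f \<in> Obj (opposite C)" "Cod (opposite C) f \<in> Obj (opposite C)" by simp_all
qed (use assms in \<open>simp_all add: Ident_in_Hom Comp_in_Hom Comp_Ident_left Comp_Ident_right\<close>)

lemma full_subcategory_simps [simp]:
  "Obj (full_subcategory C S) = Obj C \<inter> S"
  "Dom (full_subcategory C S) = Dom C" "Cod (full_subcategory C S) = Cod C"
  "Ident (full_subcategory C S) = Ident C" "Comp (full_subcategory C S) = Comp C"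
  by (simp_all add: full_subcategory_def)

lemma Arr_full_subcategory:
  "f \<in> Arr (full_subcategory C S) \<longleftrightarrow> f \<in> Arr C \<and> Dom C f \<in> S \<and> Cod C f \<in> S"
  by (simp add: full_subcategory_def)

lemma category_full_subcategory:
  assumes "category C"
  shows "category (full_subcategory C S)"
  using assms by (simp add: category_def Arr_full_subcategory in_Hom_iff)

lemma is_functor_simps:
  assumes "is_functor C D F"
  shows "category C" "category D" "X \<in> Obj C \<Longrightarrow> on_obj F X \<in> Obj D"
    "f \<in> Hom C X Y \<Longrightarrow> on_arr F f \<in> Hom D (on_obj F X) (on_obj F Y)"
    "X \<in> Obj C \<Longrightarrow> on_arr F (Ident C X) = Ident D (on_obj F X)"
    "f \<in> Hom C X Y \<Longrightarrow> g \<in> Hom C Y Z \<Longrightarrow>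
       on_arr F (Comp C g f) = Comp D (on_arr F g) (on_arr F f)"
  using assms by (auto simp: is_functor_def in_Hom_iff)

subsection \<open>Sets and presheaves\<close>

lemma SetCat_simps [simp]:
  "Obj SetCat = UNIV" "Dom SetCat = src" "Cod SetCat = tgt"
  "Ident SetCat A = Arrow A (\<lambda>x\<in>A. x) A"
  "Comp SetCat b a = Arrow (src a) (compose (src a) (fn b) (fn a)) (tgt b)"
  by (simp_all add: SetCat_def)

lemma in_Hom_SetCat: "a \<in> Hom SetCat A B \<longleftrightarrow> src a = A \<and> tgt a = B \<and> fn a \<in> A \<rightarrow>\<^sub>E B"
  by (auto simp: in_Hom_iff SetCat_def)

lemma SetCat_arrow_eqI:
  assumes "a \<in> Hom SetCat A B" "b \<in> Hom SetCat A B" "\<And>x. x \<in> A \<Longrightarrow> fn a x = fn b x"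
  shows "a = b"
proof (rule arrow.expand, intro conjI)
  show "fn a = fn b"
    using assms by (intro PiE_ext[of _ A "\<lambda>_. B"]) (auto simp: in_Hom_SetCat)
qed (use assms in \<open>simp_all add: in_Hom_SetCat\<close>)

lemma category_SetCat: "category SetCat"
proof (rule categoryI)
  fix X Y Z and f g :: "('v set, 'v \<Rightarrow> 'v) arrow"
  assume "f \<in> Hom SetCat X Y" "g \<in> Hom SetCat Y Z"
  then show "Comp SetCat g f \<in> Hom SetCat X Z"
    by (auto simp: in_Hom_SetCat PiE_iff compose_def)
next
  fix X Y and f :: "('v set, 'v \<Rightarrow> 'v) arrow"
  assume f: "f \<in> Hom SetCat X Y"
  show "Comp SetCat f (Ident SetCat X) = f"
    by (rule SetCat_arrow_eqI[OF _ f]) (use f in \<open>auto simp: in_Hom_SetCat PiE_iff compose_def\<close>)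
  show "Comp SetCat (Ident SetCat Y) f = f"
    by (rule SetCat_arrow_eqI[OF _ f]) (use f in \<open>auto simp: in_Hom_SetCat PiE_iff compose_def\<close>)
next
  fix X Y Z W and f g h :: "('v set, 'v \<Rightarrow> 'v) arrow"
  assume f: "f \<in> Hom SetCat X Y" and g: "g \<in> Hom SetCat Y Z" and h: "h \<in> Hom SetCat Z W"
  show "Comp SetCat h (Comp SetCat g f) = Comp SetCat (Comp SetCat h g) f"
    by (rule SetCat_arrow_eqI[of _ X W])
      (use f g h in \<open>auto simp: in_Hom_SetCat PiE_iff compose_def\<close>)
qed (auto simp: in_Hom_SetCat)

section \<open>Functor categories\<close>

lemma functor_category_simps [simp]:
  "Obj (functor_category C D) = functor_objects C D"
  "Dom (functor_category C D) = src" "Cod (functor_category C D) = tgt"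
  "Ident (functor_category C D) F = Arrow F (\<lambda>X\<in>Obj C. Ident D (on_obj F X)) F"
  "Comp (functor_category C D) b a =
     Arrow (src a) (\<lambda>X\<in>Obj C. Comp D (fn b X) (fn a X)) (tgt b)"
  by (simp_all add: functor_category_def)

lemma in_Hom_functor_category:
  "a \<in> Hom (functor_category C D) F G \<longleftrightarrow> src a = F \<and> tgt a = G \<and>
     F \<in> functor_objects C D \<and> G \<in> functor_objects C D \<and>
     natural_transformation C D F G (fn a) \<and> fn a \<in> extensional (Obj C)"
  by (auto simp: in_Hom_iff functor_category_def)

lemma natural_transformationI:
  assumes "\<And>X. X \<in> Obj C \<Longrightarrow> \<eta> X \<in> Hom D (on_obj F X) (on_obj G X)"
    and "\<And>X Y f. f \<in> Hom C X Y \<Longrightarrow> Comp D (\<eta> Y) (on_arr F f) = Comp D (on_arr G f) (\<eta> X)"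
  shows "natural_transformation C D F G \<eta>"
  using assms by (auto simp: natural_transformation_def in_Hom_iff)

lemma natural_transformationD:
  assumes "natural_transformation C D F G \<eta>"
  shows "X \<in> Obj C \<Longrightarrow> \<eta> X \<in> Hom D (on_obj F X) (on_obj G X)"
    and "f \<in> Hom C X Y \<Longrightarrow> Comp D (\<eta> Y) (on_arr F f) = Comp D (on_arr G f) (\<eta> X)"
  using assms by (auto simp: natural_transformation_def in_Hom_iff)

lemma natural_transformation_Comp:
  assumes F: "is_functor C D F" and G: "is_functor C D G" and H: "is_functor C D H"
    and \<eta>: "natural_transformation C D F G \<eta>" and \<theta>: "natural_transformation C D G H \<theta>"
  shows "natural_transformation C D F H (\<lambda>X\<in>Obj C. Comp D (\<theta> X) (\<eta> X))"
proof (rule natural_transformationI)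
  note D = is_functor_simps(2)[OF F]
  fix X assume X: "X \<in> Obj C"
  with natural_transformationD(1)[OF \<eta> X] natural_transformationD(1)[OF \<theta> X]
  show "(\<lambda>X\<in>Obj C. Comp D (\<theta> X) (\<eta> X)) X \<in> Hom D (on_obj F X) (on_obj H X)"
    using Comp_in_Hom[OF D] by simp
next
  note D = is_functor_simps(2)[OF F]
  fix X Y f assume f: "f \<in> Hom C X Y"
  have XY: "X \<in> Obj C" "Y \<in> Obj C"
    using Hom_Obj[OF is_functor_simps(1)[OF F] f] by auto
  note \<eta>' = natural_transformationD(1)[OF \<eta>] and \<theta>' = natural_transformationD(1)[OF \<theta>]
  have "Comp D (Comp D (\<theta> Y) (\<eta> Y)) (on_arr F f) = Comp D (\<theta> Y) (Comp D (\<eta> Y) (on_arr F f))"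
    by (rule Comp_assoc[OF D, symmetric, OF is_functor_simps(4)[OF F f] \<eta>'[OF XY(2)] \<theta>'[OF XY(2)]])
  also have "\<dots> = Comp D (\<theta> Y) (Comp D (on_arr G f) (\<eta> X))"
    by (simp add: natural_transformationD(2)[OF \<eta> f])
  also have "\<dots> = Comp D (Comp D (\<theta> Y) (on_arr G f)) (\<eta> X)"
    by (rule Comp_assoc[OF D \<eta>'[OF XY(1)] is_functor_simps(4)[OF G f] \<theta>'[OF XY(2)]])
  also have "\<dots> = Comp D (Comp D (on_arr H f) (\<theta> X)) (\<eta> X)"
    by (simp add: natural_transformationD(2)[OF \<theta> f])
  also have "\<dots> = Comp D (on_arr H f) (Comp D (\<theta> X) (\<eta> X))"
    by (rule Comp_assoc[OF D, symmetric, OF \<eta>'[OF XY(1)] \<theta>'[OF XY(1)] is_functor_simps(4)[OF H f]])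
  finally show "Comp D ((\<lambda>X\<in>Obj C. Comp D (\<theta> X) (\<eta> X)) Y) (on_arr F f) =
      Comp D (on_arr H f) ((\<lambda>X\<in>Obj C. Comp D (\<theta> X) (\<eta> X)) X)"
    using XY by simp
qed

lemma category_functor_category:
  assumes C: "category C" and D: "category D"
  shows "category (functor_category C D)"
proof (rule categoryI)
  fix F assume "F \<in> Obj (functor_category C D)"
  then have F: "is_functor C D F" "F \<in> functor_objects C D"
    by (auto simp: functor_objects_def)
  have "natural_transformation C D F F (\<lambda>X\<in>Obj C. Ident D (on_obj F X))"
  proof (rule natural_transformationI)
    fix X Y f assume f: "f \<in> Hom C X Y"
    with Hom_Obj[OF C f] is_functor_simps(4)[OF F(1) f]
    show "Comp D ((\<lambda>X\<in>Obj C. Ident D (on_obj F X)) Y) (on_arr F f) =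
        Comp D (on_arr F f) ((\<lambda>X\<in>Obj C. Ident D (on_obj F X)) X)"
      by (simp add: Comp_Ident_left[OF D] Comp_Ident_right[OF D])
  qed (simp add: Ident_in_Hom[OF D] is_functor_simps(3)[OF F(1)])
  then show "Ident (functor_category C D) F \<in> Hom (functor_category C D) F F"
    by (simp add: in_Hom_functor_category F)
next
  fix F G H a b
  assume "a \<in> Hom (functor_category C D) F G" "b \<in> Hom (functor_category C D) G H"
  then show "Comp (functor_category C D) b a \<in> Hom (functor_category C D) F H"
    by (auto simp: in_Hom_functor_category functor_objects_def intro: natural_transformation_Comp)
next
  fix F G a
  assume a: "a \<in> Hom (functor_category C D) F G"
  then have a': "\<And>X. X \<in> Obj C \<Longrightarrow> fn a X \<in> Hom D (on_obj F X) (on_obj G X)"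
    by (auto simp: in_Hom_functor_category dest: natural_transformationD)
  show "Comp (functor_category C D) a (Ident (functor_category C D) F) = a"
  proof (rule arrow.expand, intro conjI)
    show "fn (Comp (functor_category C D) a (Ident (functor_category C D) F)) = fn a"
      by (rule extensionalityI[of _ "Obj C"])
        (use a in \<open>auto simp: in_Hom_functor_category Comp_Ident_right[OF D a']\<close>)
  qed (use a in \<open>simp_all add: in_Hom_functor_category\<close>)
  show "Comp (functor_category C D) (Ident (functor_category C D) G) a = a"
  proof (rule arrow.expand, intro conjI)
    show "fn (Comp (functor_category C D) (Ident (functor_category C D) G) a) = fn a"
      by (rule extensionalityI[of _ "Obj C"])
        (use a in \<open>auto simp: in_Hom_functor_category Comp_Ident_left[OF D a']\<close>)
  qed (use a in \<open>simp_all add: in_Hom_functor_category\<close>)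
next
  fix F G H K a b c
  assume *: "a \<in> Hom (functor_category C D) F G" "b \<in> Hom (functor_category C D) G H"
    "c \<in> Hom (functor_category C D) H K"
  have "Comp D (fn c X) (Comp D (fn b X) (fn a X)) = Comp D (Comp D (fn c X) (fn b X)) (fn a X)"
    if "X \<in> Obj C" for X
    using * that
    by (intro Comp_assoc[OF D, of _ "on_obj F X" "on_obj G X" _ "on_obj H X" _ "on_obj K X"])
      (auto simp: in_Hom_functor_category dest: natural_transformationD)
  then show "Comp (functor_category C D) c (Comp (functor_category C D) b a) =
      Comp (functor_category C D) (Comp (functor_category C D) c b) a"
    by (auto intro: restrict_ext)
qed (auto simp: functor_category_def)

lemma category_Psh: "category C \<Longrightarrow> category (Psh C)"
  unfolding Psh_def by (intro category_functor_category category_opposite category_SetCat)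

lemma Obj_Psh [simp]: "Obj (Psh C) = functor_objects (opposite C) SetCat"
  by (simp add: Psh_def)

section \<open>Presheaves and their arrows in terms of elements\<close>

lemma presheaf_restrict:
  assumes "F \<in> Obj (Psh C)" "g \<in> Hom C V U"
  shows "on_arr F g \<in> Hom SetCat (on_obj F U) (on_obj F V)"
    and "v \<in> on_obj F U \<Longrightarrow> fn (on_arr F g) v \<in> on_obj F V"
proof -
  show "on_arr F g \<in> Hom SetCat (on_obj F U) (on_obj F V)"
    using assms is_functor_simps(4)[of "opposite C" SetCat F g U V] by (simp add: functor_objects_def)
  then show "v \<in> on_obj F U \<Longrightarrow> fn (on_arr F g) v \<in> on_obj F V"
    by (auto simp: in_Hom_SetCat)
qed

text \<open>Naturality becomes an equation between elements instead of an equation between arrows of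
  \<open>SetCat\<close>. All later arguments about presheaves go through this form.\<close>

lemma in_Hom_Psh_iff:
  assumes "category C"
  shows "\<alpha> \<in> Hom (Psh C) F G \<longleftrightarrow> src \<alpha> = F \<and> tgt \<alpha> = G \<and> F \<in> Obj (Psh C) \<and> G \<in> Obj (Psh C) \<and>
     fn \<alpha> \<in> extensional (Obj C) \<and>
     (\<forall>U\<in>Obj C. fn \<alpha> U \<in> Hom SetCat (on_obj F U) (on_obj G U)) \<and>
     (\<forall>U V g v. g \<in> Hom C V U \<longrightarrow> v \<in> on_obj F U \<longrightarrow>
        fn (fn \<alpha> V) (fn (on_arr F g) v) = fn (on_arr G g) (fn (fn \<alpha> U) v))"
    (is "_ \<longleftrightarrow> ?R")
proof
  assume "\<alpha> \<in> Hom (Psh C) F G"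
  then have *: "src \<alpha> = F" "tgt \<alpha> = G" "F \<in> Obj (Psh C)" "G \<in> Obj (Psh C)"
    and ext: "fn \<alpha> \<in> extensional (Obj C)"
    and nat: "natural_transformation (opposite C) SetCat F G (fn \<alpha>)"
    by (auto simp: Psh_def in_Hom_functor_category)
  have "fn (fn \<alpha> V) (fn (on_arr F g) v) = fn (on_arr G g) (fn (fn \<alpha> U) v)"
    if g: "g \<in> Hom C V U" and v: "v \<in> on_obj F U" for U V g v
  proof -
    have eq: "Comp SetCat (fn \<alpha> V) (on_arr F g) = Comp SetCat (on_arr G g) (fn \<alpha> U)"
      using natural_transformationD(2)[OF nat, of g U V] g unfolding Hom_opposite by blast
    \<comment> \<open>Composition in \<open>SetCat\<close> restricts to the source of the inner
      factor. Both composites thus live on \<open>on_obj F U\<close>, which is where they can be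
      evaluated at \<open>v\<close>.\<close>
    have "src (on_arr F g) = on_obj F U"
      using presheaf_restrict(1)[OF *(3) g] by (simp add: in_Hom_SetCat)
    moreover have "src (fn \<alpha> U) = on_obj F U"
      using natural_transformationD(1)[OF nat, of U] Hom_Obj(2)[OF assms g]
      by (simp add: in_Hom_SetCat)
    ultimately show ?thesis
      using fun_cong[OF arg_cong[OF eq, of fn], of v] v by (simp add: compose_def)
  qed
  then show ?R
    using * ext natural_transformationD(1)[OF nat] by simp
next
  assume R: ?R
  have "natural_transformation (opposite C) SetCat F G (fn \<alpha>)"
  proof (rule natural_transformationI)
    fix U V g assume "g \<in> Hom (opposite C) U V"
    then have g: "g \<in> Hom C V U" by simp
    note UV = Hom_Obj[OF assms g]
    have "on_arr F g \<in> Hom SetCat (on_obj F U) (on_obj F V)"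
      "on_arr G g \<in> Hom SetCat (on_obj G U) (on_obj G V)"
      "fn \<alpha> U \<in> Hom SetCat (on_obj F U) (on_obj G U)"
      "fn \<alpha> V \<in> Hom SetCat (on_obj F V) (on_obj G V)"
      using R UV presheaf_restrict(1)[OF _ g] by auto
    then show "Comp SetCat (fn \<alpha> V) (on_arr F g) = Comp SetCat (on_arr G g) (fn \<alpha> U)"
      using R g by (auto simp: in_Hom_SetCat compose_def intro!: restrict_ext)
  qed (use R in auto)
  with R show "\<alpha> \<in> Hom (Psh C) F G"
    by (auto simp: Psh_def in_Hom_functor_category)
qed

lemma Psh_arrow_apply_in:
  assumes "category C" "\<alpha> \<in> Hom (Psh C) F G" "U \<in> Obj C" "v \<in> on_obj F U"
  shows "fn (fn \<alpha> U) v \<in> on_obj G U"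
  using assms by (auto simp: in_Hom_Psh_iff in_Hom_SetCat)

lemma Psh_arrow_eqI:
  assumes C: "category C" and a: "\<alpha> \<in> Hom (Psh C) F G" and b: "\<beta> \<in> Hom (Psh C) F G"
    and eq: "\<And>U v. U \<in> Obj C \<Longrightarrow> v \<in> on_obj F U \<Longrightarrow> fn (fn \<alpha> U) v = fn (fn \<beta> U) v"
  shows "\<alpha> = \<beta>"
proof (rule arrow.expand, intro conjI)
  show "fn \<alpha> = fn \<beta>"
  proof (rule extensionalityI)
    fix U assume "U \<in> Obj C"
    then show "fn \<alpha> U = fn \<beta> U"
      using a b eq unfolding in_Hom_Psh_iff[OF C]
      by (intro SetCat_arrow_eqI[of _ "on_obj F U" "on_obj G U"]) auto
  qed (use a b in \<open>auto simp: in_Hom_Psh_iff[OF C]\<close>)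
qed (use a b in \<open>auto simp: in_Hom_Psh_iff[OF C]\<close>)

lemma Comp_Psh_apply:
  assumes "category C" "\<alpha> \<in> Hom (Psh C) F G" "U \<in> Obj C" "v \<in> on_obj F U"
  shows "fn (fn (Comp (Psh C) \<beta> \<alpha>) U) v = fn (fn \<beta> U) (fn (fn \<alpha> U) v)"
proof -
  have "src (fn \<alpha> U) = on_obj F U"
    using assms(1-3) by (simp add: in_Hom_Psh_iff in_Hom_SetCat)
  then show ?thesis
    using assms(3,4) by (simp add: Psh_def compose_def)
qed

lemma Ident_Psh_apply:
  assumes "U \<in> Obj C" "v \<in> on_obj F U"
  shows "fn (fn (Ident (Psh C) F) U) v = v"
  using assms by (simp add: Psh_def)

text \<open>Common shape of the two kinds of presheaf arrows that have to be constructed: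
  postcomposition with an arrow of \<open>C\<close>, and the mediating arrow of a limit. The
  restrictions make the result extensional, so only the functions \<open>e U\<close> matter.\<close>

definition presheaf_map ::
    "('o, 'm) cat \<Rightarrow> ('o, 'm, 'v) presheaf \<Rightarrow> ('o, 'm, 'v) presheaf \<Rightarrow> ('o \<Rightarrow> 'v \<Rightarrow> 'v) \<Rightarrow>
     (('o, 'm, 'v) presheaf, 'o \<Rightarrow> ('v set, 'v \<Rightarrow> 'v) arrow) arrow" where
  "presheaf_map C F G e = Arrow F
     (\<lambda>U\<in>Obj C. Arrow (on_obj F U) (\<lambda>v\<in>on_obj F U. e U v) (on_obj G U)) G"

lemma presheaf_map_apply [simp]:
  "U \<in> Obj C \<Longrightarrow> v \<in> on_obj F U \<Longrightarrow> fn (fn (presheaf_map C F G e) U) v = e U v"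
  by (simp add: presheaf_map_def)

lemma presheaf_map_in_Hom:
  assumes C: "category C" and F: "F \<in> Obj (Psh C)" and G: "G \<in> Obj (Psh C)"
    and e: "\<And>U v. U \<in> Obj C \<Longrightarrow> v \<in> on_obj F U \<Longrightarrow> e U v \<in> on_obj G U"
    and nat: "\<And>U V g v. g \<in> Hom C V U \<Longrightarrow> v \<in> on_obj F U \<Longrightarrow>
      e V (fn (on_arr F g) v) = fn (on_arr G g) (e U v)"
  shows "presheaf_map C F G e \<in> Hom (Psh C) F G"
  unfolding in_Hom_Psh_iff[OF C]
proof (intro conjI allI impI)
  fix U V g v assume g: "g \<in> Hom C V U" and v: "v \<in> on_obj F U"
  show "fn (fn (presheaf_map C F G e) V) (fn (on_arr F g) v) =
      fn (on_arr G g) (fn (fn (presheaf_map C F G e) U) v)"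
    using Hom_Obj[OF C g] v presheaf_restrict(2)[OF F g v] nat[OF g v] by simp
qed (use F G e in \<open>auto simp: presheaf_map_def in_Hom_SetCat\<close>)

section \<open>The restricted Yoneda functor\<close>

locale restricted_yoneda_embedding =
  fixes C P :: "('o, 'm) cat" and S :: "'o set" and \<phi> :: "'m \<Rightarrow> 'v"
  assumes C: "category C" and P: "P = full_subcategory C S" and inj: "inj_on \<phi> (Arr C)"
begin

abbreviation (input) "h \<equiv> hom_presheaf C P \<phi>"
abbreviation (input) "y \<equiv> restricted_yoneda C P \<phi>"

text \<open>Injectivity of \<open>\<phi>\<close> on all arrows makes decoding independent of the
  hom-set in which the arrow lies; one \<open>inv_into\<close> serves every \<open>X\<close> and
  \<open>U\<close>.\<close>

lemma decode [simp]: "f \<in> Hom C X Y \<Longrightarrow> inv_into (Arr C) \<phi> (\<phi> f) = f"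
  using inj by (auto simp: in_Hom_iff)

lemma encode_eq_iff: "f \<in> Hom C X Y \<Longrightarrow> g \<in> Hom C X' Y' \<Longrightarrow> \<phi> f = \<phi> g \<longleftrightarrow> f = g"
  using inj by (auto simp: in_Hom_iff inj_on_def)

lemma P_simps [simp]:
  "Obj P = Obj C \<inter> S" "Dom P = Dom C" "Cod P = Cod C" "Ident P = Ident C" "Comp P = Comp C"
  by (simp_all add: P)

lemma Arr_P: "f \<in> Arr P \<longleftrightarrow> f \<in> Arr C \<and> Dom C f \<in> S \<and> Cod C f \<in> S"
  by (simp add: P Arr_full_subcategory)

lemma category_P: "category P"
  by (simp add: P category_full_subcategory[OF C])

lemma Hom_P: "f \<in> Hom P X Y \<longleftrightarrow> f \<in> Hom C X Y \<and> X \<in> S \<and> Y \<in> S"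
  by (auto simp: in_Hom_iff Arr_P)

lemma on_obj_hom_presheaf: "U \<in> Obj P \<Longrightarrow> on_obj (h X) U = \<phi> ` Hom C U X"
  by (simp add: hom_presheaf_def)

lemma on_arr_hom_presheaf:
  assumes "g \<in> Hom P V U" "f \<in> Hom C U X"
  shows "fn (on_arr (h X) g) (\<phi> f) = \<phi> (Comp C f g)"
  using assms by (auto simp: hom_presheaf_def in_Hom_iff inj)

section \<open>The presheaves \<open>h X\<close> and the functor \<open>y\<close>\<close>

text \<open>The unit law and associativity of \<open>C\<close>, read on codes, are the two functor
  laws for precomposition.\<close>

lemma hom_presheaf_in_Psh:
  assumes "X \<in> Obj C"
  shows "h X \<in> Obj (Psh P)"
proof -
  have arr: "on_arr (h X) g \<in> Hom SetCat (on_obj (h X) U) (on_obj (h X) V)"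
    if g: "g \<in> Hom P V U" for g U V
  proof -
    have "g \<in> Hom C V U" "V \<in> Obj P" "U \<in> Obj P" "g \<in> Arr P" "Dom C g = V" "Cod C g = U"
      using g Hom_Obj[OF category_P g] by (auto simp: in_Hom_iff Arr_P)
    then show ?thesis
      by (auto simp: in_Hom_SetCat hom_presheaf_def intro: Comp_in_Hom[OF C])
  qed
  have "is_functor (opposite P) SetCat (h X)"
    unfolding is_functor_def
  proof (intro conjI ballI impI)
    fix g assume "g \<in> Arr (opposite P)"
    then show "on_arr (h X) g \<in>
        Hom SetCat (on_obj (h X) (Dom (opposite P) g)) (on_obj (h X) (Cod (opposite P) g))"
      using arr[of g "Dom C g" "Cod C g"] by (simp add: in_Hom_iff)
  next
    fix U assume "U \<in> Obj (opposite P)"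
    then have U: "U \<in> Obj P" by simp
    note I = Ident_in_Hom[OF category_P U]
    show "on_arr (h X) (Ident (opposite P) U) = Ident SetCat (on_obj (h X) U)"
    proof (rule SetCat_arrow_eqI)
      show "on_arr (h X) (Ident (opposite P) U) \<in> Hom SetCat (on_obj (h X) U) (on_obj (h X) U)"
        using arr[OF I] by simp
      show "Ident SetCat (on_obj (h X) U) \<in> Hom SetCat (on_obj (h X) U) (on_obj (h X) U)"
        by (auto simp: in_Hom_SetCat)
      fix v assume v: "v \<in> on_obj (h X) U"
      then obtain f where f: "f \<in> Hom C U X" "v = \<phi> f"
        by (auto simp: on_obj_hom_presheaf[OF U])
      then show "fn (on_arr (h X) (Ident (opposite P) U)) v = fn (Ident SetCat (on_obj (h X) U)) v"
        using v on_arr_hom_presheaf[OF I f(1)] Comp_Ident_right[OF C f(1)] by simp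
    qed
  next
    fix a b assume "a \<in> Arr (opposite P)" "b \<in> Arr (opposite P)"
      and "Cod (opposite P) a = Dom (opposite P) b"
    then obtain U V W where a: "a \<in> Hom P V U" and b: "b \<in> Hom P W V"
      by (auto simp: in_Hom_iff)
    have ab: "Comp P a b \<in> Hom P W U"
      using Comp_in_Hom[OF category_P b a] .
    have U: "U \<in> Obj P" using Hom_Obj[OF category_P a] by simp
    show "on_arr (h X) (Comp (opposite P) b a) = Comp SetCat (on_arr (h X) b) (on_arr (h X) a)"
    proof (rule SetCat_arrow_eqI)
      show "on_arr (h X) (Comp (opposite P) b a) \<in> Hom SetCat (on_obj (h X) U) (on_obj (h X) W)"
        using arr[OF ab] by simp
      show "Comp SetCat (on_arr (h X) b) (on_arr (h X) a)
          \<in> Hom SetCat (on_obj (h X) U) (on_obj (h X) W)"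
        by (rule Comp_in_Hom[OF category_SetCat arr[OF a] arr[OF b]])
      fix v assume v: "v \<in> on_obj (h X) U"
      then obtain f where f: "f \<in> Hom C U X" "v = \<phi> f"
        by (auto simp: on_obj_hom_presheaf[OF U])
      have C': "a \<in> Hom C V U" "b \<in> Hom C W V" using a b by (auto simp: Hom_P)
      show "fn (on_arr (h X) (Comp (opposite P) b a)) v =
          fn (Comp SetCat (on_arr (h X) b) (on_arr (h X) a)) v"
        using v arr[OF a] f on_arr_hom_presheaf[OF a f(1)] on_arr_hom_presheaf[OF ab f(1)]
          on_arr_hom_presheaf[OF b Comp_in_Hom[OF C C'(1) f(1)]] Comp_assoc[OF C C'(2,1) f(1)]
        by (simp add: in_Hom_SetCat compose_def)
    qed
  qed (use category_opposite[OF category_P] category_SetCat in auto)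
  then show ?thesis
    by (auto simp: functor_objects_def hom_presheaf_def)
qed

lemma on_obj_restricted_yoneda: "on_obj y X = h X"
  by (simp add: restricted_yoneda_def)

lemma restricted_yoneda_eq_presheaf_map:
  "f \<in> Hom C X Y \<Longrightarrow>
    on_arr y f = presheaf_map P (h X) (h Y) (\<lambda>U v. \<phi> (Comp C f (inv_into (Arr C) \<phi> v)))"
  unfolding restricted_yoneda_def presheaf_map_def
  by (auto simp: in_Hom_iff on_obj_hom_presheaf intro!: restrict_ext)

lemma restricted_yoneda_apply:
  assumes "f \<in> Hom C X Y" "U \<in> Obj P" "g \<in> Hom C U X"
  shows "fn (fn (on_arr y f) U) (\<phi> g) = \<phi> (Comp C f g)"
  using assms by (simp add: restricted_yoneda_eq_presheaf_map on_obj_hom_presheaf)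

text \<open>Naturality is associativity: composing with \<open>f\<close> on the left commutes with
  composing with \<open>g\<close> on the right.\<close>

lemma restricted_yoneda_in_Hom:
  assumes f: "f \<in> Hom C X Y"
  shows "on_arr y f \<in> Hom (Psh P) (h X) (h Y)"
  unfolding restricted_yoneda_eq_presheaf_map[OF f]
proof (rule presheaf_map_in_Hom[OF category_P])
  fix U V g v assume g: "g \<in> Hom P V U" and v: "v \<in> on_obj (h X) U"
  obtain k where k: "k \<in> Hom C U X" "v = \<phi> k"
    using v Hom_Obj[OF category_P g] by (auto simp: on_obj_hom_presheaf)
  have g': "g \<in> Hom C V U" using g by (simp add: Hom_P)
  note kg = Comp_in_Hom[OF C g' k(1)] and fk = Comp_in_Hom[OF C k(1) f]
  show "\<phi> (Comp C f (inv_into (Arr C) \<phi> (fn (on_arr (h X) g) v))) =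
      fn (on_arr (h Y) g) (\<phi> (Comp C f (inv_into (Arr C) \<phi> v)))"
    using k kg fk by (simp add: on_arr_hom_presheaf[OF g] Comp_assoc[OF C g' k(1) f])
qed (use f Hom_Obj[OF C f] in \<open>auto simp: on_obj_hom_presheaf hom_presheaf_in_Psh[simplified]
  intro: Comp_in_Hom[OF C]\<close>)

lemma is_functor_restricted_yoneda: "is_functor C (Psh P) y"
  unfolding is_functor_def
proof (intro conjI ballI impI)
  show "category C" "category (Psh P)" by (fact C category_Psh[OF category_P])+
  fix X assume X: "X \<in> Obj C"
  then show "on_obj y X \<in> Obj (Psh P)"
    using hom_presheaf_in_Psh by (simp add: on_obj_restricted_yoneda)
  note I = Ident_in_Hom[OF C X]
  show "on_arr y (Ident C X) = Ident (Psh P) (on_obj y X)"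
    unfolding on_obj_restricted_yoneda
  proof (rule Psh_arrow_eqI[OF category_P restricted_yoneda_in_Hom[OF I]
        Ident_in_Hom[OF category_Psh[OF category_P] hom_presheaf_in_Psh[OF X]]])
    fix U v assume U: "U \<in> Obj P" and v: "v \<in> on_obj (h X) U"
    obtain k where k: "k \<in> Hom C U X" "v = \<phi> k"
      using v U by (auto simp: on_obj_hom_presheaf)
    show "fn (fn (on_arr y (Ident C X)) U) v = fn (fn (Ident (Psh P) (h X)) U) v"
      unfolding Ident_Psh_apply[OF U v]
      using k by (simp add: restricted_yoneda_apply[OF I U] Comp_Ident_left[OF C])
  qed
next
  fix f assume "f \<in> Arr C"
  then show "on_arr y f \<in> Hom (Psh P) (on_obj y (Dom C f)) (on_obj y (Cod C f))"
    using restricted_yoneda_in_Hom by (simp add: on_obj_restricted_yoneda in_Hom_iff)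
next
  fix f g assume "f \<in> Arr C" "g \<in> Arr C" "Cod C f = Dom C g"
  then obtain X Y Z where f: "f \<in> Hom C X Y" and g: "g \<in> Hom C Y Z"
    by (auto simp: in_Hom_iff)
  note gf = Comp_in_Hom[OF C f g]
  show "on_arr y (Comp C g f) = Comp (Psh P) (on_arr y g) (on_arr y f)"
  proof (rule Psh_arrow_eqI[OF category_P restricted_yoneda_in_Hom[OF gf]
        Comp_in_Hom[OF category_Psh[OF category_P] restricted_yoneda_in_Hom[OF f]
          restricted_yoneda_in_Hom[OF g]]])
    fix U v assume U: "U \<in> Obj P" and v: "v \<in> on_obj (h X) U"
    obtain k where k: "k \<in> Hom C U X" "v = \<phi> k"
      using v U by (auto simp: on_obj_hom_presheaf)
    show "fn (fn (on_arr y (Comp C g f)) U) v =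
        fn (fn (Comp (Psh P) (on_arr y g) (on_arr y f)) U) v"
      unfolding Comp_Psh_apply[OF category_P restricted_yoneda_in_Hom[OF f] U v]
      using k by (simp add: restricted_yoneda_apply[OF f U k(1)] restricted_yoneda_apply[OF gf U k(1)]
          restricted_yoneda_apply[OF g U Comp_in_Hom[OF C k(1) f]] Comp_assoc[OF C k(1) f g])
  qed
qed

section \<open>Preservation of monomorphisms and limits\<close>

text \<open>At an element \<open>v\<close> of \<open>Q U\<close> the two competing presheaf arrows
  take values that encode arrows \<open>k\<close> and \<open>l\<close> from \<open>U\<close> to
  \<open>X\<close>. Equality of the composites gives \<open>f k = f l\<close>, and the monomorphism
  \<open>f\<close> is cancelled in \<open>C\<close> itself.\<close>

lemma preserves_monos_restricted_yoneda: "preserves_monos C (Psh P) y"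
  unfolding preserves_monos_def
proof (intro allI impI)
  fix f assume mono: "monomorphism C f"
  then obtain X Y where f: "f \<in> Hom C X Y"
    by (auto simp: monomorphism_def in_Hom_iff)
  note yf = restricted_yoneda_in_Hom[OF f]
  show "monomorphism (Psh P) (on_arr y f)"
    unfolding monomorphism_def
  proof (intro conjI ballI impI)
    show "on_arr y f \<in> Arr (Psh P)" using yf by (simp add: in_Hom_iff)
    fix \<alpha> \<beta>
    assume "\<alpha> \<in> Arr (Psh P)" "\<beta> \<in> Arr (Psh P)" "Cod (Psh P) \<alpha> = Dom (Psh P) (on_arr y f)"
      "Cod (Psh P) \<beta> = Dom (Psh P) (on_arr y f)" "Dom (Psh P) \<alpha> = Dom (Psh P) \<beta>"
      and eq: "Comp (Psh P) (on_arr y f) \<alpha> = Comp (Psh P) (on_arr y f) \<beta>"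
    then obtain Q where a: "\<alpha> \<in> Hom (Psh P) Q (h X)" and b: "\<beta> \<in> Hom (Psh P) Q (h X)"
      using yf by (auto simp: in_Hom_iff)
    show "\<alpha> = \<beta>"
    proof (rule Psh_arrow_eqI[OF category_P a b])
      fix U v assume U: "U \<in> Obj P" and v: "v \<in> on_obj Q U"
      obtain k l where k: "k \<in> Hom C U X" "fn (fn \<alpha> U) v = \<phi> k"
        and l: "l \<in> Hom C U X" "fn (fn \<beta> U) v = \<phi> l"
        using Psh_arrow_apply_in[OF category_P a U v] Psh_arrow_apply_in[OF category_P b U v] U
        by (auto simp: on_obj_hom_presheaf)
      have "\<phi> (Comp C f k) = \<phi> (Comp C f l)"
        using arg_cong[OF eq, of "\<lambda>\<gamma>. fn (fn \<gamma> U) v"] k l U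
        by (simp add: Comp_Psh_apply[OF category_P a U v] Comp_Psh_apply[OF category_P b U v]
            restricted_yoneda_apply[OF f U])
      then have "Comp C f k = Comp C f l"
        using encode_eq_iff Comp_in_Hom[OF C k(1) f] Comp_in_Hom[OF C l(1) f] by blast
      then have "k = l"
        using mono k l f by (auto simp: monomorphism_def in_Hom_iff)
      with k l show "fn (fn \<alpha> U) v = fn (fn \<beta> U) v" by simp
    qed
  qed
qed

text \<open>An element of \<open>Q U\<close> for a cone \<open>(Q, q)\<close> of presheaves is sent by \<open>q\<close> to a cone in \<open>C\<close> with
  apex \<open>U\<close>, so the mediating map is found objectwise.\<close>

lemma preserves_limits_restricted_yoneda: "preserves_limits J C (Psh P) y"
  unfolding preserves_limits_def
proof (intro allI impI)
  fix G A p
  assume G: "is_functor J C G" and lim: "is_limit J C G A p"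
  note J = is_functor_simps(1)[OF G]
  have A: "A \<in> Obj C" and p: "\<And>j. j \<in> Obj J \<Longrightarrow> p j \<in> Hom C A (on_obj G j)"
    and pk: "\<And>k. k \<in> Arr J \<Longrightarrow> Comp C (on_arr G k) (p (Dom J k)) = p (Cod J k)"
    and univ: "\<And>B q. is_cone J C G B q \<Longrightarrow>
      \<exists>!u. u \<in> Hom C B A \<and> (\<forall>j\<in>Obj J. Comp C (p j) u = q j)"
    using lim by (auto simp: is_limit_def is_cone_def)
  note yp = restricted_yoneda_in_Hom[OF p]
  note Gk = is_functor_simps(4)[OF G]
  show "is_limit J (Psh P) (comp_functor y G) (on_obj y A) (on_arr y \<circ> p)"
    unfolding is_limit_def on_obj_restricted_yoneda
  proof (intro conjI allI impI)
    show "is_cone J (Psh P) (comp_functor y G) (h A) (on_arr y \<circ> p)"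
      unfolding is_cone_def
    proof (intro conjI ballI)
      show "h A \<in> Obj (Psh P)" by (rule hom_presheaf_in_Psh[OF A])
      show "(on_arr y \<circ> p) j \<in> Hom (Psh P) (h A) (on_obj (comp_functor y G) j)"
        if "j \<in> Obj J" for j
        using yp[OF that] by (simp add: comp_functor_def on_obj_restricted_yoneda)
      fix k assume k: "k \<in> Arr J"
      then have k': "k \<in> Hom J (Dom J k) (Cod J k)" by (simp add: in_Hom_iff)
      show "Comp (Psh P) (on_arr (comp_functor y G) k) ((on_arr y \<circ> p) (Dom J k)) =
          (on_arr y \<circ> p) (Cod J k)"
        using is_functor_simps(6)[OF is_functor_restricted_yoneda p[OF Hom_Obj(1)[OF J k']] Gk[OF k']]
        by (simp add: comp_functor_def pk[OF k])
    qed
    fix Q q assume cone: "is_cone J (Psh P) (comp_functor y G) Q q"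
    then have Q: "Q \<in> Obj (Psh P)"
      and q: "\<And>j. j \<in> Obj J \<Longrightarrow> q j \<in> Hom (Psh P) Q (h (on_obj G j))"
      and qk: "\<And>k. k \<in> Arr J \<Longrightarrow> Comp (Psh P) (on_arr y (on_arr G k)) (q (Dom J k)) = q (Cod J k)"
      by (auto simp: is_cone_def comp_functor_def on_obj_restricted_yoneda)
    \<comment> \<open>The component \<open>q j\<close> sends \<open>v\<close> to the code of an
      arrow from \<open>U\<close> to \<open>on_obj G j\<close>; this is that arrow. For fixed
      \<open>U\<close> and \<open>v\<close> these arrows form the legs of the cone in
      \<open>C\<close>.\<close>
    define c where "c U v j = inv_into (Arr C) \<phi> (fn (fn (q j) U) v)" for U v j
    have c: "c U v j \<in> Hom C U (on_obj G j)" "fn (fn (q j) U) v = \<phi> (c U v j)"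
      if "U \<in> Obj P" "v \<in> on_obj Q U" "j \<in> Obj J" for U v j
      using Psh_arrow_apply_in[OF category_P q[OF that(3)] that(1,2)] that(1)
      by (auto simp: c_def on_obj_hom_presheaf)
    have c_cone: "is_cone J C G U (c U v)" if U: "U \<in> Obj P" and v: "v \<in> on_obj Q U" for U v
      unfolding is_cone_def
    proof (intro conjI ballI)
      fix k assume k: "k \<in> Arr J"
      then have k': "k \<in> Hom J (Dom J k) (Cod J k)" by (simp add: in_Hom_iff)
      note dc = Hom_Obj[OF J k'] and c1 = c[OF U v]
      have "\<phi> (Comp C (on_arr G k) (c U v (Dom J k))) = \<phi> (c U v (Cod J k))"
        using arg_cong[OF qk[OF k], of "\<lambda>\<gamma>. fn (fn \<gamma> U) v"] dc
        by (simp add: Comp_Psh_apply[OF category_P q[OF dc(1)] U v] c1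
            restricted_yoneda_apply[OF Gk[OF k'] U c1(1)[OF dc(1)]])
      then show "Comp C (on_arr G k) (c U v (Dom J k)) = c U v (Cod J k)"
        using encode_eq_iff Comp_in_Hom[OF C c1(1)[OF dc(1)] Gk[OF k']] c1(1)[OF dc(2)] by blast
    qed (use U c[OF U v] in auto)
    define m where "m U v = (THE u. u \<in> Hom C U A \<and> (\<forall>j\<in>Obj J. Comp C (p j) u = c U v j))" for U v
    have m: "m U v \<in> Hom C U A" "\<And>j. j \<in> Obj J \<Longrightarrow> Comp C (p j) (m U v) = c U v j"
      if "U \<in> Obj P" "v \<in> on_obj Q U" for U v
      using theI'[OF univ[OF c_cone[OF that]]] by (auto simp: m_def)
    have m_unique: "u = m U v"
      if "U \<in> Obj P" "v \<in> on_obj Q U" "u \<in> Hom C U A"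
        "\<And>j. j \<in> Obj J \<Longrightarrow> Comp C (p j) u = c U v j" for U v u
      using univ[OF c_cone[OF that(1,2)]] m[OF that(1,2)] that(3,4) by blast
    define \<mu> where "\<mu> = presheaf_map P Q (h A) (\<lambda>U v. \<phi> (m U v))"
    have \<mu>: "\<mu> \<in> Hom (Psh P) Q (h A)"
      unfolding \<mu>_def
    proof (rule presheaf_map_in_Hom[OF category_P Q hom_presheaf_in_Psh[OF A]])
      fix U V g v assume g: "g \<in> Hom P V U" and v: "v \<in> on_obj Q U"
      have g': "g \<in> Hom C V U" using g by (simp add: Hom_P)
      note UV = Hom_Obj[OF category_P g] and v' = presheaf_restrict(2)[OF Q g v]
      note mv = m[OF UV(2) v]
      \<comment> \<open>Each \<open>m U v\<close> was chosen separately, so naturality has to be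
        earned: by naturality of every \<open>q j\<close>, both sides mediate the cone attached to
        the restricted element, and mediating arrows are unique.\<close>
      have "Comp C (m U v) g = m V (fn (on_arr Q g) v)"
      proof (rule m_unique[OF UV(1) v'])
        show "Comp C (m U v) g \<in> Hom C V A" by (rule Comp_in_Hom[OF C g' mv(1)])
        fix j assume j: "j \<in> Obj J"
        have "\<phi> (c V (fn (on_arr Q g) v) j) = \<phi> (Comp C (c U v j) g)"
          using q[OF j] g v c[OF UV(1) v' j] c[OF UV(2) v j]
          by (auto simp: in_Hom_Psh_iff[OF category_P] on_arr_hom_presheaf)
        then have "Comp C (c U v j) g = c V (fn (on_arr Q g) v) j"
          using encode_eq_iff c(1)[OF UV(1) v' j] Comp_in_Hom[OF C g' c(1)[OF UV(2) v j]] by metis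
        then show "Comp C (p j) (Comp C (m U v) g) = c V (fn (on_arr Q g) v) j"
          by (simp add: Comp_assoc[OF C g' mv(1) p[OF j]] mv(2)[OF j])
      qed
      then show "\<phi> (m V (fn (on_arr Q g) v)) = fn (on_arr (h A) g) (\<phi> (m U v))"
        by (simp add: on_arr_hom_presheaf[OF g mv(1)])
    qed (use m in \<open>auto simp: on_obj_hom_presheaf\<close>)
    show "\<exists>!u. u \<in> Hom (Psh P) Q (h A) \<and> (\<forall>j\<in>Obj J. Comp (Psh P) ((on_arr y \<circ> p) j) u = q j)"
    proof (rule ex1I[of _ \<mu>], intro conjI ballI)
      show "\<mu> \<in> Hom (Psh P) Q (h A)" by (rule \<mu>)
      fix j assume j: "j \<in> Obj J"
      have "Comp (Psh P) (on_arr y (p j)) \<mu> = q j"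
      proof (rule Psh_arrow_eqI[OF category_P
            Comp_in_Hom[OF category_Psh[OF category_P] \<mu> yp[OF j]] q[OF j]])
        fix U v assume U: "U \<in> Obj P" and v: "v \<in> on_obj Q U"
        note mv = m[OF U v]
        show "fn (fn (Comp (Psh P) (on_arr y (p j)) \<mu>) U) v = fn (fn (q j) U) v"
          unfolding Comp_Psh_apply[OF category_P \<mu> U v]
          using c(2)[OF U v j] mv(2)[OF j] U v
          by (simp add: restricted_yoneda_apply[OF p[OF j] U mv(1)] \<mu>_def)
      qed
      then show "Comp (Psh P) ((on_arr y \<circ> p) j) \<mu> = q j" by simp
    next
      fix \<nu> assume "\<nu> \<in> Hom (Psh P) Q (h A) \<and>
        (\<forall>j\<in>Obj J. Comp (Psh P) ((on_arr y \<circ> p) j) \<nu> = q j)"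
      then have \<nu>: "\<nu> \<in> Hom (Psh P) Q (h A)"
        and \<nu>q: "\<And>j. j \<in> Obj J \<Longrightarrow> Comp (Psh P) (on_arr y (p j)) \<nu> = q j" by auto
      show "\<nu> = \<mu>"
      proof (rule Psh_arrow_eqI[OF category_P \<nu> \<mu>])
        fix U v assume U: "U \<in> Obj P" and v: "v \<in> on_obj Q U"
        obtain k where k: "k \<in> Hom C U A" "fn (fn \<nu> U) v = \<phi> k"
          using Psh_arrow_apply_in[OF category_P \<nu> U v] U by (auto simp: on_obj_hom_presheaf)
        \<comment> \<open>Any other mediating presheaf arrow yields at \<open>v\<close> an arrow
          that mediates the cone of \<open>v\<close> in \<open>C\<close>, so uniqueness is inherited
          from \<open>A\<close>.\<close>
        have "k = m U v"
        proof (rule m_unique[OF U v k(1)])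
          fix j assume j: "j \<in> Obj J"
          have "\<phi> (Comp C (p j) k) = \<phi> (c U v j)"
            using arg_cong[OF \<nu>q[OF j], of "\<lambda>\<gamma>. fn (fn \<gamma> U) v"] c(2)[OF U v j] k(2)
            by (simp add: Comp_Psh_apply[OF category_P \<nu> U v] restricted_yoneda_apply[OF p[OF j] U k(1)])
          then show "Comp C (p j) k = c U v j"
            using encode_eq_iff Comp_in_Hom[OF C k(1) p[OF j]] c(1)[OF U v j] by blast
        qed
        then show "fn (fn \<nu> U) v = fn (fn \<mu> U) v"
          using k U v by (simp add: \<mu>_def)
      qed
    qed
  qed
qed

end

section \<open>The category of local epo-spaces\<close>

lemma of_epo_simps [simp]: "space_of (of_epo T R) = T" "atlas (of_epo T R) = {(topspace T, R)}"
  by (simp_all add: of_epo_def)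

lemma
  assumes X: "local_epo_space X" and U: "(U, R) \<in> atlas X"
  shows atlas_openin: "openin (space_of X) U"
    and atlas_epo_space: "epo_space (subtopology (space_of X) U) R"
    and atlas_order_subset: "R \<subseteq> U \<times> U"
    and atlas_order_refl: "x \<in> U \<Longrightarrow> (x, x) \<in> R"
proof -
  show *: "openin (space_of X) U" "epo_space (subtopology (space_of X) U) R"
    using X U by (auto simp: local_epo_space_def is_chart_def)
  then have top: "topspace (subtopology (space_of X) U) = U"
    by (auto dest: openin_subset)
  note epo = *(2)[unfolded epo_space_def top, THEN conjunct2]
  show "R \<subseteq> U \<times> U"
    by (rule epo[THEN conjunct1])
  have "refl_on U R"
    using epo[THEN conjunct2, THEN conjunct1] by (simp add: partial_order_on_def preorder_on_def)
  then show "x \<in> U \<Longrightarrow> (x, x) \<in> R"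
    by (rule refl_onD)
qed

lemma atlas_covers:
  assumes "local_epo_space X" "x \<in> topspace (space_of X)"
  obtains U R where "(U, R) \<in> atlas X" "x \<in> U"
proof -
  have "x \<in> \<Union>(fst ` atlas X)"
    using assms by (simp add: local_epo_space_def)
  then obtain c where "c \<in> atlas X" "x \<in> fst c" by blast
  then show thesis by (intro that[of "fst c" "snd c"]) simp_all
qed

lemma atlas_compatible:
  assumes "local_epo_space X" "(U, R) \<in> atlas X" "(V, S) \<in> atlas X"
    and "a \<in> V" "b \<in> V" "(a, b) \<in> R"
  shows "(a, b) \<in> S"
proof -
  have "compatible_charts (U, R) (V, S)"
    using assms(1-3) by (simp add: local_epo_space_def)
  moreover have "(a, b) \<in> U \<times> U"
    using atlas_order_subset[OF assms(1,2)] assms(6) by blast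
  ultimately show ?thesis
    using assms(4-6) by (auto simp: compatible_charts_def restrict_order_def)
qed

section \<open>Dimaps: local criteria, composition and gluing\<close>

text \<open>Membership in the chart and in the preimage of \<open>V\<close> is moved into the
  implication, so that the neighbourhood \<open>N\<close> can be chosen freely among the open sets
  of \<open>X\<close>; the proof cuts it down to the subspace.\<close>

lemma dimapI:
  assumes "continuous_map (space_of X) (space_of Y) f"
    and "\<And>U R V S x. (U, R) \<in> atlas X \<Longrightarrow> (V, S) \<in> atlas Y \<Longrightarrow> x \<in> U \<Longrightarrow>
      x \<in> topspace (space_of X) \<Longrightarrow> f x \<in> V \<Longrightarrow>
      \<exists>N. openin (space_of X) N \<and> x \<in> N \<and>
        (\<forall>a\<in>N \<inter> U. \<forall>b\<in>N \<inter> U. f a \<in> V \<longrightarrow> f b \<in> V \<longrightarrow> (a, b) \<in> R \<longrightarrow> (f a, f b) \<in> S)"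
  shows "dimap X Y f"
proof -
  have "locally_nondecreasing (subtopology (space_of X) (f -` V \<inter> U)) R S f"
    if "(U, R) \<in> atlas X" "(V, S) \<in> atlas Y" for U R V S
    unfolding locally_nondecreasing_def
  proof
    fix x assume "x \<in> topspace (subtopology (space_of X) (f -` V \<inter> U))"
    then have x: "x \<in> U" "x \<in> topspace (space_of X)" "f x \<in> V" by auto
    from assms(2)[OF that x] obtain N where N: "openin (space_of X) N" "x \<in> N"
      and mono: "\<forall>a\<in>N \<inter> U. \<forall>b\<in>N \<inter> U. f a \<in> V \<longrightarrow> f b \<in> V \<longrightarrow> (a, b) \<in> R \<longrightarrow> (f a, f b) \<in> S"
      by blast
    show "\<exists>N. openin (subtopology (space_of X) (f -` V \<inter> U)) N \<and> x \<in> N \<and>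
        monotone_on N (\<lambda>a b. (a, b) \<in> R) (\<lambda>a b. (a, b) \<in> S) f"
      using N x mono
      by (intro exI[of _ "N \<inter> (f -` V \<inter> U)"])
        (auto simp: openin_subtopology monotone_on_def)
  qed
  with assms(1) show ?thesis by (auto simp: dimap_def)
qed

text \<open>The elimination form is as strong as possible: since charts are open and
  \<open>f\<close> is continuous, a neighbourhood in the subspace is already open in
  \<open>X\<close>.\<close>

lemma dimapD:
  assumes "local_epo_space X" "local_epo_space Y" and f: "dimap X Y f"
    and U: "(U, R) \<in> atlas X" and V: "(V, S) \<in> atlas Y" and x: "x \<in> U" "f x \<in> V"
  obtains N where "openin (space_of X) N" "x \<in> N" "N \<subseteq> U" "f ` N \<subseteq> V"
    "\<And>a b. a \<in> N \<Longrightarrow> b \<in> N \<Longrightarrow> (a, b) \<in> R \<Longrightarrow> (f a, f b) \<in> S"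
proof -
  have U': "openin (space_of X) U" and V': "openin (space_of Y) V"
    using atlas_openin assms by blast+
  have cont: "continuous_map (space_of X) (space_of Y) f"
    and "locally_nondecreasing (subtopology (space_of X) (f -` V \<inter> U)) R S f"
    using f U V by (auto simp: dimap_def)
  moreover have "x \<in> topspace (subtopology (space_of X) (f -` V \<inter> U))"
    using x openin_subset[OF U'] by auto
  ultimately obtain N where N: "openin (subtopology (space_of X) (f -` V \<inter> U)) N" "x \<in> N"
    and mono: "monotone_on N (\<lambda>a b. (a, b) \<in> R) (\<lambda>a b. (a, b) \<in> S) f"
    unfolding locally_nondecreasing_def by blast
  from N(1) obtain T where T: "openin (space_of X) T" "N = T \<inter> (f -` V \<inter> U)"
    by (auto simp: openin_subtopology)
  \<comment> \<open>The preimage under \<open>f\<close> is taken in the whole type. Inside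
    \<open>U\<close>, which lies in the space, it agrees with the preimage within the space, and
    continuity makes the latter open.\<close>
  then have "N = T \<inter> {z \<in> topspace (space_of X). f z \<in> V} \<inter> U"
    using openin_subset[OF U'] by auto
  then have "openin (space_of X) N"
    using T(1) U' openin_continuous_map_preimage[OF cont V'] by auto
  then show thesis
    using that[of N] N(2) T(2) mono by (auto simp: monotone_on_def)
qed

lemma dimap_continuous: "dimap X Y f \<Longrightarrow> continuous_map (space_of X) (space_of Y) f"
  by (simp add: dimap_def)

lemma dimap_in_topspace:
  "dimap X Y f \<Longrightarrow> x \<in> topspace (space_of X) \<Longrightarrow> f x \<in> topspace (space_of Y)"
  by (auto dest!: dimap_continuous simp: continuous_map_def)

text \<open>Arrows store extensional functions. This allows passing between a map and its
  restriction to the points of \<open>X\<close>, and between two descriptions of a map on a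
  chart.\<close>

lemma dimap_cong:
  assumes "local_epo_space X" "local_epo_space Y" "dimap X Y f"
    and eq: "\<And>x. x \<in> topspace (space_of X) \<Longrightarrow> f x = g x"
  shows "dimap X Y g"
proof (rule dimapI)
  show "continuous_map (space_of X) (space_of Y) g"
    using dimap_continuous[OF assms(3)] eq by (rule continuous_map_eq)
  fix U R V S x
  assume U: "(U, R) \<in> atlas X" and V: "(V, S) \<in> atlas Y" and x: "x \<in> U"
    "x \<in> topspace (space_of X)" "g x \<in> V"
  then have "f x \<in> V" by (simp add: eq)
  from dimapD[OF assms(1-3) U V x(1) this] obtain N where
    N: "openin (space_of X) N" "x \<in> N" "\<And>a b. a \<in> N \<Longrightarrow> b \<in> N \<Longrightarrow> (a, b) \<in> R \<Longrightarrow> (f a, f b) \<in> S"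
    by metis
  then have "N \<subseteq> topspace (space_of X)" by (auto dest: openin_subset)
  then show "\<exists>N. openin (space_of X) N \<and> x \<in> N \<and>
      (\<forall>a\<in>N \<inter> U. \<forall>b\<in>N \<inter> U. g a \<in> V \<longrightarrow> g b \<in> V \<longrightarrow> (a, b) \<in> R \<longrightarrow> (g a, g b) \<in> S)"
    using N eq by (intro exI[of _ N]) (auto simp: subset_iff)
qed

lemma dimap_id: "local_epo_space X \<Longrightarrow> dimap X X (\<lambda>x. x)"
  by (rule dimapI) (auto intro: atlas_compatible)

text \<open>A related pair must pass through one intermediate chart \<open>V\<close> that contains
  both of its images. A chart around \<open>f x\<close> does so for pairs close to \<open>x\<close>,
  which is exactly what local monotonicity asks for.\<close>

lemma dimap_compose:
  assumes X: "local_epo_space X" and Y: "local_epo_space Y" and Z: "local_epo_space Z"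
    and f: "dimap X Y f" and g: "dimap Y Z g"
  shows "dimap X Z (\<lambda>x. g (f x))"
proof (rule dimapI)
  show "continuous_map (space_of X) (space_of Z) (\<lambda>x. g (f x))"
    using continuous_map_compose[OF dimap_continuous[OF f] dimap_continuous[OF g]]
    by (simp add: comp_def)
  fix U R W Q x
  assume U: "(U, R) \<in> atlas X" and W: "(W, Q) \<in> atlas Z" and x: "x \<in> U"
    "x \<in> topspace (space_of X)" "g (f x) \<in> W"
  obtain V S where V: "(V, S) \<in> atlas Y" "f x \<in> V"
    using atlas_covers[OF Y dimap_in_topspace[OF f x(2)]] .
  obtain M where M: "openin (space_of X) M" "x \<in> M"
    "\<And>a b. a \<in> M \<Longrightarrow> b \<in> M \<Longrightarrow> (a, b) \<in> R \<Longrightarrow> (f a, f b) \<in> S"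
    using dimapD[OF X Y f U V(1) x(1) V(2)] by metis
  obtain N where N: "openin (space_of Y) N" "f x \<in> N"
    "\<And>a b. a \<in> N \<Longrightarrow> b \<in> N \<Longrightarrow> (a, b) \<in> S \<Longrightarrow> (g a, g b) \<in> Q"
    using dimapD[OF Y Z g V(1) W V(2) x(3)] by metis
  \<comment> \<open>On this set \<open>f\<close> is monotone into \<open>S\<close> and lands where
    \<open>g\<close> is monotone from \<open>S\<close> into \<open>Q\<close>.\<close>
  have "openin (space_of X) (M \<inter> {z \<in> topspace (space_of X). f z \<in> N})"
    using M(1) openin_continuous_map_preimage[OF dimap_continuous[OF f] N(1)] by auto
  then show "\<exists>N. openin (space_of X) N \<and> x \<in> N \<and> (\<forall>a\<in>N \<inter> U. \<forall>b\<in>N \<inter> U.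
      g (f a) \<in> W \<longrightarrow> g (f b) \<in> W \<longrightarrow> (a, b) \<in> R \<longrightarrow> (g (f a), g (f b)) \<in> Q)"
    using x(2) M N by (intro exI[of _ "M \<inter> {z \<in> topspace (space_of X). f z \<in> N}"]) auto
qed

text \<open>The pairs in \<open>\<C>\<close> abstract two covers: the atlas of \<open>X\<close>
  itself, used for fullness, and an open dicover with the inherited orders, used for the sheaf
  property. As each \<open>W\<close> is open, neighbourhoods inside \<open>W\<close> are
  neighbourhoods in \<open>X\<close>.\<close>

lemma dimap_glue:
  assumes X: "local_epo_space X" and Y: "local_epo_space Y"
    and cover: "\<And>x. x \<in> topspace (space_of X) \<Longrightarrow> \<exists>(W, Q)\<in>\<C>. x \<in> W"
    and op: "\<And>W Q. (W, Q) \<in> \<C> \<Longrightarrow> openin (space_of X) W"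
    and compat: "\<And>W Q U R. (W, Q) \<in> \<C> \<Longrightarrow> (U, R) \<in> atlas X \<Longrightarrow> compatible_charts (U, R) (W, Q)"
    and sub: "\<And>W Q. (W, Q) \<in> \<C> \<Longrightarrow> local_epo_space (of_epo (subtopology (space_of X) W) Q)"
    and f: "\<And>W Q. (W, Q) \<in> \<C> \<Longrightarrow> dimap (of_epo (subtopology (space_of X) W) Q) Y f"
  shows "dimap X Y f"
proof (rule dimapI)
  have topW: "topspace (subtopology (space_of X) W) = W" if "(W, Q) \<in> \<C>" for W Q
    using openin_subset[OF op[OF that]] by auto
  show "continuous_map (space_of X) (space_of Y) f"
    unfolding continuous_map_def
  proof (intro conjI allI impI)
    show "f \<in> topspace (space_of X) \<rightarrow> topspace (space_of Y)"
    proof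
      fix x assume "x \<in> topspace (space_of X)"
      then obtain W Q where W: "(W, Q) \<in> \<C>" "x \<in> W" using cover by blast
      then show "f x \<in> topspace (space_of Y)"
        using dimap_in_topspace[OF f[OF W(1)], of x] W(2)
        unfolding of_epo_simps topW[OF W(1)] by blast
    qed
    fix V assume V: "openin (space_of Y) V"
    show "openin (space_of X) {x \<in> topspace (space_of X). f x \<in> V}"
    proof (subst openin_subopen, intro ballI)
      fix x assume x: "x \<in> {x \<in> topspace (space_of X). f x \<in> V}"
      then obtain W Q where W: "(W, Q) \<in> \<C>" "x \<in> W" using cover by blast
      have "openin (subtopology (space_of X) W) {z \<in> W. f z \<in> V}"
        using openin_continuous_map_preimage[OF dimap_continuous[OF f[OF W(1)]] V]
        unfolding of_epo_simps topW[OF W(1)] .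
      then have "openin (space_of X) {z \<in> W. f z \<in> V}"
        using op[OF W(1)] by (simp add: openin_open_subtopology)
      then show "\<exists>T. openin (space_of X) T \<and> x \<in> T \<and> T \<subseteq> {x \<in> topspace (space_of X). f x \<in> V}"
        using x W(2) openin_subset[OF op[OF W(1)]]
        by (intro exI[of _ "{z \<in> W. f z \<in> V}"]) auto
    qed
  qed
  fix U R V S x
  assume U: "(U, R) \<in> atlas X" and V: "(V, S) \<in> atlas Y" and x: "x \<in> U"
    "x \<in> topspace (space_of X)" "f x \<in> V"
  then obtain W Q where W: "(W, Q) \<in> \<C>" "x \<in> W" using cover by blast
  have "(W, Q) \<in> atlas (of_epo (subtopology (space_of X) W) Q)"
    using topW[OF W(1)] by simp
  then obtain N where N: "openin (subtopology (space_of X) W) N" "x \<in> N" "N \<subseteq> W"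
    and mono: "\<And>a b. a \<in> N \<Longrightarrow> b \<in> N \<Longrightarrow> (a, b) \<in> Q \<Longrightarrow> (f a, f b) \<in> S"
    using dimapD[OF sub[OF W(1)] Y f[OF W(1)] _ V W(2) x(3)] by (metis of_epo_simps(1))
  \<comment> \<open>Since \<open>N\<close> lies in \<open>W\<close>, such a pair lies in the overlap
    of \<open>U\<close> and \<open>W\<close>, where the two orders agree.\<close>
  have "(a, b) \<in> Q" if "a \<in> N \<inter> U" "b \<in> N \<inter> U" "(a, b) \<in> R" for a b
    using compat[OF W(1) U] that N(3) by (auto simp: compatible_charts_def restrict_order_def)
  with mono N show "\<exists>N. openin (space_of X) N \<and> x \<in> N \<and>
      (\<forall>a\<in>N \<inter> U. \<forall>b\<in>N \<inter> U. f a \<in> V \<longrightarrow> f b \<in> V \<longrightarrow> (a, b) \<in> R \<longrightarrow> (f a, f b) \<in> S)"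
    using op[OF W(1)] by (intro exI[of _ N]) (auto simp: openin_open_subtopology)
qed

section \<open>Arrows and composition in \<open>LEpo\<close>\<close>

lemma LEpo_simps [simp]:
  "X \<in> Obj LEpo \<longleftrightarrow> local_epo_space X" "Dom LEpo = src" "Cod LEpo = tgt"
  by (simp_all add: LEpo_def)

lemma Ident_LEpo: "Ident LEpo X = Arrow X (\<lambda>x\<in>topspace (space_of X). x) X"
  by (simp add: LEpo_def)

lemma Comp_LEpo:
  "Comp LEpo b a = Arrow (src a) (compose (topspace (space_of (src a))) (fn b) (fn a)) (tgt b)"
  by (simp add: LEpo_def)

lemma in_Hom_LEpo:
  "f \<in> Hom LEpo X Y \<longleftrightarrow> src f = X \<and> tgt f = Y \<and> local_epo_space X \<and> local_epo_space Y \<and>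
     dimap X Y (fn f) \<and> fn f \<in> extensional (topspace (space_of X))"
  by (auto simp: in_Hom_iff LEpo_def)

lemma restrict_in_Hom_LEpo:
  assumes "local_epo_space X" "local_epo_space Y" "dimap X Y f"
  shows "Arrow X (restrict f (topspace (space_of X))) Y \<in> Hom LEpo X Y"
  using assms by (auto simp: in_Hom_LEpo intro: dimap_cong)

lemma LEpo_arrow_eqI:
  assumes "f \<in> Hom LEpo X Y" "g \<in> Hom LEpo X Y"
    and "\<And>x. x \<in> topspace (space_of X) \<Longrightarrow> fn f x = fn g x"
  shows "f = g"
proof (rule arrow.expand, intro conjI)
  show "fn f = fn g"
    by (rule extensionalityI[of _ "topspace (space_of X)"])
      (use assms in \<open>auto simp: in_Hom_LEpo\<close>)
qed (use assms in \<open>simp_all add: in_Hom_LEpo\<close>)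

lemma Comp_LEpo_apply:
  assumes "f \<in> Hom LEpo X Y" "x \<in> topspace (space_of X)"
  shows "fn (Comp LEpo g f) x = fn g (fn f x)"
  using assms by (simp add: in_Hom_LEpo Comp_LEpo compose_def)

lemma Hom_LEpo_in_topspace:
  "f \<in> Hom LEpo X Y \<Longrightarrow> x \<in> topspace (space_of X) \<Longrightarrow> fn f x \<in> topspace (space_of Y)"
  by (auto simp: in_Hom_LEpo dimap_in_topspace)

lemma Comp_LEpo_in_Hom:
  assumes "f \<in> Hom LEpo X Y" "g \<in> Hom LEpo Y Z"
  shows "Comp LEpo g f \<in> Hom LEpo X Z"
proof -
  have "dimap X Z (\<lambda>x. fn g (fn f x))"
    using assms by (intro dimap_compose[of X Y Z]) (simp_all add: in_Hom_LEpo)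
  then show ?thesis
    using restrict_in_Hom_LEpo[of X Z "\<lambda>x. fn g (fn f x)"] assms
    by (simp add: in_Hom_LEpo Comp_LEpo compose_def)
qed

lemma category_LEpo: "category LEpo"
proof (rule categoryI)
  fix X assume "X \<in> Obj (LEpo :: ('a local_epo, 'a dimap_arrow) cat)"
  then show I: "Ident LEpo X \<in> Hom LEpo X X"
    using restrict_in_Hom_LEpo[OF _ _ dimap_id] by (simp add: Ident_LEpo)
next
  fix X Y and f :: "'a dimap_arrow" assume f: "f \<in> Hom LEpo X Y"
  then have "local_epo_space X" "local_epo_space Y" by (simp_all add: in_Hom_LEpo)
  then have I: "Ident LEpo X \<in> Hom LEpo X X" "Ident LEpo Y \<in> Hom LEpo Y Y"
    using restrict_in_Hom_LEpo[OF _ _ dimap_id] by (simp_all add: Ident_LEpo)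
  show "Comp LEpo f (Ident LEpo X) = f"
    by (rule LEpo_arrow_eqI[OF Comp_LEpo_in_Hom[OF I(1) f] f])
      (simp only: Comp_LEpo_apply[OF I(1)], simp add: Ident_LEpo)
  show "Comp LEpo (Ident LEpo Y) f = f"
    by (rule LEpo_arrow_eqI[OF Comp_LEpo_in_Hom[OF f I(2)] f])
      (simp add: Comp_LEpo_apply[OF f] Hom_LEpo_in_topspace[OF f] Ident_LEpo)
next
  fix X Y Z W and f g k :: "'a dimap_arrow"
  assume f: "f \<in> Hom LEpo X Y" and g: "g \<in> Hom LEpo Y Z" and k: "k \<in> Hom LEpo Z W"
  note gf = Comp_LEpo_in_Hom[OF f g] and kg = Comp_LEpo_in_Hom[OF g k]
  show "Comp LEpo k (Comp LEpo g f) = Comp LEpo (Comp LEpo k g) f"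
    by (rule LEpo_arrow_eqI[OF Comp_LEpo_in_Hom[OF gf k] Comp_LEpo_in_Hom[OF f kg]])
      (simp add: Comp_LEpo_apply[OF f] Comp_LEpo_apply[OF g] Comp_LEpo_apply[OF gf]
        Hom_LEpo_in_topspace[OF f])
qed (auto simp: LEpo_def[THEN arg_cong[of _ _ Arr]] intro: Comp_LEpo_in_Hom)

section \<open>Epo-spaces and points\<close>

abbreviation epo_objects :: "'a local_epo set" where
  "epo_objects \<equiv> {X. \<exists>T R. epo_space T R \<and> X = of_epo T R}"

lemma local_epo_space_of_epo: "epo_space T R \<Longrightarrow> local_epo_space (of_epo T R)"
  by (simp add: local_epo_space_def is_chart_def compatible_charts_def)

lemma Obj_Epo: "X \<in> Obj Epo \<longleftrightarrow> X \<in> epo_objects"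
  by (auto simp: Epo_def local_epo_space_of_epo)

lemma Obj_Epo_local_epo_space: "X \<in> Obj Epo \<Longrightarrow> local_epo_space X"
  by (simp add: Epo_def)

lemma Epo_simps [simp]: "Dom Epo = src" "Cod Epo = tgt" "Comp Epo = Comp LEpo"
  by (simp_all add: Epo_def)

lemma in_Hom_Epo: "f \<in> Hom Epo X Y \<longleftrightarrow> f \<in> Hom LEpo X Y \<and> X \<in> Obj Epo \<and> Y \<in> Obj Epo"
  by (auto simp: in_Hom_iff Epo_def Arr_full_subcategory LEpo_def)

lemma chart_in_Obj_Epo:
  assumes "local_epo_space X" "(U, R) \<in> atlas X"
  shows "of_epo (subtopology (space_of X) U) R \<in> Obj Epo"
  using atlas_epo_space[OF assms] by (auto simp: Obj_Epo)

text \<open>Compatibility of the atlas is what makes the inclusion monotone towards every chart of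
  \<open>X\<close>, not only towards \<open>(U, R)\<close>. These inclusions are the elements at
  which a natural transformation is tested to recover a dimap.\<close>

lemma chart_inclusion_in_Hom:
  assumes X: "local_epo_space X" and U: "(U, R) \<in> atlas X"
  shows "Arrow (of_epo (subtopology (space_of X) U) R) (\<lambda>x\<in>U. x) X
    \<in> Hom LEpo (of_epo (subtopology (space_of X) U) R) X"
proof -
  have top: "topspace (subtopology (space_of X) U) = U"
    using openin_subset[OF atlas_openin[OF X U]] by auto
  have "dimap (of_epo (subtopology (space_of X) U) R) X (\<lambda>x. x)"
  proof (rule dimapI)
    show "continuous_map (space_of (of_epo (subtopology (space_of X) U) R)) (space_of X) (\<lambda>x. x)"
      by (simp add: continuous_map_from_subtopology)
    fix U' R' V S x
    assume "(U', R') \<in> atlas (of_epo (subtopology (space_of X) U) R)" and V: "(V, S) \<in> atlas X"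
      and x: "x \<in> U'"
    then have "U' = U" "R' = R" using top by auto
    \<comment> \<open>The whole chart serves as the neighbourhood, because compatibility holds on
      the full overlap.\<close>
    then show "\<exists>N. openin (space_of (of_epo (subtopology (space_of X) U) R)) N \<and> x \<in> N \<and>
        (\<forall>a\<in>N \<inter> U'. \<forall>b\<in>N \<inter> U'. a \<in> V \<longrightarrow> b \<in> V \<longrightarrow> (a, b) \<in> R' \<longrightarrow> (a, b) \<in> S)"
      using x top atlas_compatible[OF X U V] by (intro exI[of _ U]) (auto simp: openin_subtopology_refl
          dest: openin_subset[OF atlas_openin[OF X U], THEN subsetD])
  qed
  from restrict_in_Hom_LEpo[OF local_epo_space_of_epo[OF atlas_epo_space[OF X U]] X this]
  show ?thesis unfolding of_epo_simps top .
qed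

section \<open>The one-point space\<close>

text \<open>The point has to be an element of the universe \<open>'a\<close>;
  \<open>undefined\<close> is one that every type provides.\<close>

definition point_space :: "'a local_epo" where
  "point_space = of_epo (discrete_topology {undefined}) {(undefined, undefined)}"

definition point_at :: "'a local_epo \<Rightarrow> 'a \<Rightarrow> 'a dimap_arrow" where
  "point_at X x = Arrow point_space (\<lambda>_\<in>{undefined}. x) X"

lemma topspace_point_space [simp]: "topspace (space_of point_space) = {undefined}"
  by (simp add: point_space_def)

lemma fn_point_at [simp]: "fn (point_at X x) undefined = x"
  by (simp add: point_at_def)

lemma point_space_in_Obj_Epo: "point_space \<in> Obj Epo"
proof -
  \<comment> \<open>In dimension 0 all coordinates vanish. The index \<open>0 - 1\<close> is 0 on
    naturals, so the half-space condition reads \<open>0 \<ge> 0\<close> and the half-space is a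
    single point.\<close>
  have "topspace (half_space 0) = {\<lambda>_. 0}"
    by (auto simp: half_space_def topspace_Euclidean_space)
  then have "discrete_topology {undefined :: 'a} homeomorphic_space half_space 0"
    unfolding homeomorphic_space_def homeomorphic_maps_def
    by (intro exI[of _ "\<lambda>_ _. 0"] exI[of _ "\<lambda>_. undefined"]) auto
  \<comment> \<open>The order is closed because the product of discrete topologies is
    discrete.\<close>
  then have "epo_space (discrete_topology {undefined}) {(undefined :: 'a, undefined)}"
    unfolding epo_space_def
    by (intro conjI exI[of _ 0] exI[of _ "topspace (half_space 0)"])
      (auto simp: partial_order_on_def preorder_on_def refl_on_def trans_def antisym_def
        simp flip: prod_topology_discrete_topology)
  then show ?thesis by (auto simp: Obj_Epo point_space_def)
qed

lemma local_epo_space_point_space: "local_epo_space point_space"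
  by (rule Obj_Epo_local_epo_space[OF point_space_in_Obj_Epo])

text \<open>Constant maps are monotone by reflexivity of the orders on the charts.\<close>

lemma point_at_in_Hom:
  assumes X: "local_epo_space X" and x: "x \<in> topspace (space_of X)"
  shows "point_at X x \<in> Hom LEpo point_space X"
proof -
  have "dimap point_space X (\<lambda>_. x)"
    by (rule dimapI) (use x in \<open>auto simp: atlas_order_refl[OF X] intro!: exI[of _ "topspace (space_of point_space)"]\<close>)
  from restrict_in_Hom_LEpo[OF local_epo_space_point_space X this]
  show ?thesis by (simp add: point_at_def)
qed

text \<open>Composing with a point is evaluation: this identifies arrows out of
  \<open>point_space\<close> with points, naturally in \<open>X\<close>, and turns naturality
  statements into statements about values.\<close>

lemma Comp_point_at:
  assumes f: "f \<in> Hom LEpo X Y" and x: "x \<in> topspace (space_of X)"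
  shows "Comp LEpo f (point_at X x) = point_at Y (fn f x)"
proof (rule LEpo_arrow_eqI)
  have XY: "local_epo_space X" "local_epo_space Y" using f by (auto simp: in_Hom_LEpo)
  note px = point_at_in_Hom[OF XY(1) x]
  show "Comp LEpo f (point_at X x) \<in> Hom LEpo point_space Y"
    by (rule Comp_LEpo_in_Hom[OF px f])
  show "point_at Y (fn f x) \<in> Hom LEpo point_space Y"
    by (rule point_at_in_Hom[OF XY(2) Hom_LEpo_in_topspace[OF f x]])
  show "fn (Comp LEpo f (point_at X x)) z = fn (point_at Y (fn f x)) z"
    if "z \<in> topspace (space_of point_space)" for z
    using that by (simp add: Comp_LEpo_apply[OF px])
qed

section \<open>Full faithfulness and the sheaf property\<close>

lemma restricted_yoneda_embedding_LEpo:
  "inj_on \<phi> (Arr LEpo) \<Longrightarrow> restricted_yoneda_embedding LEpo Epo epo_objects \<phi>"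
  by unfold_locales (auto simp: category_LEpo Epo_def)

text \<open>Faithfulness is read off at \<open>point_space\<close>. For fullness, the map
  \<open>f\<close> of points induced by \<open>\<alpha>\<close> satisfies: \<open>\<alpha>\<close>
  sends \<open>g\<close> to an arrow with values \<open>f (g u)\<close>. Taking the inclusion of a
  chart for \<open>g\<close> shows that \<open>f\<close> is a dimap on that chart.\<close>

lemma fully_faithful_restricted_yoneda_Epo:
  fixes \<phi> :: "'a dimap_arrow \<Rightarrow> 'v"
  assumes inj: "inj_on \<phi> (Arr LEpo)"
  shows "fully_faithful LEpo (Psh Epo) (restricted_yoneda LEpo Epo \<phi>)"
proof -
  interpret restricted_yoneda_embedding LEpo Epo epo_objects \<phi>
    by (rule restricted_yoneda_embedding_LEpo[OF inj])
  have "bij_betw (on_arr y) (Hom LEpo X Y) (Hom (Psh Epo) (h X) (h Y))"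
    if X: "local_epo_space X" and Y: "local_epo_space Y" for X Y
    unfolding bij_betw_def
  proof
    show "inj_on (on_arr y) (Hom LEpo X Y)"
    proof (rule inj_onI)
      fix f g assume f: "f \<in> Hom LEpo X Y" and g: "g \<in> Hom LEpo X Y" and eq: "on_arr y f = on_arr y g"
      show "f = g"
      proof (rule LEpo_arrow_eqI[OF f g])
        fix x assume x: "x \<in> topspace (space_of X)"
        note px = point_at_in_Hom[OF X x]
        have "\<phi> (Comp LEpo f (point_at X x)) = \<phi> (Comp LEpo g (point_at X x))"
          using restricted_yoneda_apply[OF f point_space_in_Obj_Epo px]
            restricted_yoneda_apply[OF g point_space_in_Obj_Epo px] eq by simp
        then have "Comp LEpo f (point_at X x) = Comp LEpo g (point_at X x)"
          using encode_eq_iff Comp_LEpo_in_Hom[OF px f] Comp_LEpo_in_Hom[OF px g] by blast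
        then have "point_at Y (fn f x) = point_at Y (fn g x)"
          by (simp only: Comp_point_at[OF f x] Comp_point_at[OF g x])
        then show "fn f x = fn g x" by (metis fn_point_at)
      qed
    qed
    show "on_arr y ` Hom LEpo X Y = Hom (Psh Epo) (h X) (h Y)"
    proof
      show "on_arr y ` Hom LEpo X Y \<subseteq> Hom (Psh Epo) (h X) (h Y)"
        using restricted_yoneda_in_Hom by blast
      show "Hom (Psh Epo) (h X) (h Y) \<subseteq> on_arr y ` Hom LEpo X Y"
      proof
        fix \<alpha> assume \<alpha>: "\<alpha> \<in> Hom (Psh Epo) (h X) (h Y)"
        define e where "e U g = inv_into (Arr LEpo) \<phi> (fn (fn \<alpha> U) (\<phi> g))" for U g
        have e: "e U g \<in> Hom LEpo U Y" "fn (fn \<alpha> U) (\<phi> g) = \<phi> (e U g)"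
          if U: "U \<in> Obj Epo" and g: "g \<in> Hom LEpo U X" for U g
          using Psh_arrow_apply_in[OF category_P \<alpha> U, of "\<phi> g"] U g
          by (auto simp: on_obj_hom_presheaf e_def)
        have e_nat: "e V (Comp LEpo g k) = Comp LEpo (e U g) k"
          if U: "U \<in> Obj Epo" and V: "V \<in> Obj Epo" and g: "g \<in> Hom LEpo U X"
            and k: "k \<in> Hom LEpo V U" for U V g k
        proof -
          have k': "k \<in> Hom Epo V U" using U V k by (simp add: in_Hom_Epo)
          note gk = Comp_LEpo_in_Hom[OF k g]
          have "fn (fn \<alpha> V) (fn (on_arr (h X) k) (\<phi> g)) = fn (on_arr (h Y) k) (fn (fn \<alpha> U) (\<phi> g))"
            using \<alpha> k' g U unfolding in_Hom_Psh_iff[OF category_P] on_obj_hom_presheaf[OF U]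
            by (auto simp: on_obj_hom_presheaf)
          then have "\<phi> (e V (Comp LEpo g k)) = \<phi> (Comp LEpo (e U g) k)"
            by (simp only: on_arr_hom_presheaf[OF k' g] e(2)[OF U g] e(2)[OF V gk]
                on_arr_hom_presheaf[OF k' e(1)[OF U g]])
          then show ?thesis
            using encode_eq_iff e(1)[OF V gk] Comp_LEpo_in_Hom[OF k e(1)[OF U g]] by blast
        qed
        \<comment> \<open>The effect of \<open>\<alpha>\<close> on points. Outside the space of
          \<open>X\<close> the values are arbitrary; they disappear when \<open>f\<close> is
          restricted to form \<open>?F\<close>.\<close>
        define f where "f x = fn (e point_space (point_at X x)) undefined" for x
        have f: "fn (e U g) u = f (fn g u)"
          if U: "U \<in> Obj Epo" and g: "g \<in> Hom LEpo U X" and u: "u \<in> topspace (space_of U)" for U g u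
        proof -
          note pu = point_at_in_Hom[OF Obj_Epo_local_epo_space[OF U] u]
          \<comment> \<open>Naturality along the point \<open>u\<close> of \<open>U\<close>, with
            both composites evaluated.\<close>
          have "e point_space (point_at X (fn g u)) = point_at Y (fn (e U g) u)"
            using e_nat[OF U point_space_in_Obj_Epo g pu]
            by (simp only: Comp_point_at[OF g u] Comp_point_at[OF e(1)[OF U g] u])
          then show ?thesis by (simp add: f_def)
        qed
        have "dimap X Y f"
        proof (rule dimap_glue[OF X Y, where \<C> = "atlas X"])
          fix W Q assume W: "(W, Q) \<in> atlas X"
          note Epo = chart_in_Obj_Epo[OF X W] and incl = chart_inclusion_in_Hom[OF X W]
          note eW = e(1)[OF Epo incl]
          show "local_epo_space (of_epo (subtopology (space_of X) W) Q)"
            by (rule Obj_Epo_local_epo_space[OF Epo])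
          show "dimap (of_epo (subtopology (space_of X) W) Q) Y f"
          proof (rule dimap_cong[OF Obj_Epo_local_epo_space[OF Epo] Y])
            show "dimap (of_epo (subtopology (space_of X) W) Q) Y
                (fn (e (of_epo (subtopology (space_of X) W) Q)
                  (Arrow (of_epo (subtopology (space_of X) W) Q) (\<lambda>x\<in>W. x) X)))"
              using eW by (simp add: in_Hom_LEpo)
          qed (use f[OF Epo incl] in simp)
        next
          fix x assume "x \<in> topspace (space_of X)"
          then obtain W Q where "(W, Q) \<in> atlas X" "x \<in> W"
            using atlas_covers[OF X] by metis
          then show "\<exists>(W, Q)\<in>atlas X. x \<in> W"
            by (intro bexI[of _ "(W, Q)"]) simp_all
        qed (use X in \<open>auto simp: local_epo_space_def intro: atlas_openin[OF X]\<close>)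
        from restrict_in_Hom_LEpo[OF X Y this]
        have F: "Arrow X (restrict f (topspace (space_of X))) Y \<in> Hom LEpo X Y" (is "?F \<in> _") .
        have "on_arr y ?F = \<alpha>"
        proof (rule Psh_arrow_eqI[OF category_P restricted_yoneda_in_Hom[OF F] \<alpha>])
          fix U v assume U: "U \<in> Obj Epo" and "v \<in> on_obj (h X) U"
          then obtain g where g: "g \<in> Hom LEpo U X" "v = \<phi> g"
            by (auto simp: on_obj_hom_presheaf)
          have "Comp LEpo ?F g = e U g"
            by (rule LEpo_arrow_eqI[OF Comp_LEpo_in_Hom[OF g(1) F] e(1)[OF U g(1)]])
              (simp add: Comp_LEpo_apply[OF g(1)] f[OF U g(1)] Hom_LEpo_in_topspace[OF g(1)])
          then show "fn (fn (on_arr y ?F) U) v = fn (fn \<alpha> U) v"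
            by (simp only: g(2) restricted_yoneda_apply[OF F U g(1)] e(2)[OF U g(1)])
        qed
        with F show "\<alpha> \<in> on_arr y ` Hom LEpo X Y" by blast
      qed
    qed
  qed
  then show ?thesis
    using is_functor_restricted_yoneda by (simp add: fully_faithful_def on_obj_restricted_yoneda)
qed

text \<open>A covering sieve contains all points of \<open>X\<close>, so a matching family already
  prescribes the amalgamation pointwise. Every member of the family is a restriction of this single
  map, which replaces the usual comparison on intersections of cover members.\<close>

lemma is_sheaf_hom_presheaf_Epo:
  fixes \<phi> :: "'a dimap_arrow \<Rightarrow> 'v"
  assumes inj: "inj_on \<phi> (Arr LEpo)" and Y: "local_epo_space Y"
  shows "is_sheaf Epo open_dicover_topology (hom_presheaf LEpo Epo \<phi> Y)"
proof -
  interpret restricted_yoneda_embedding LEpo Epo epo_objects \<phi>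
    by (rule restricted_yoneda_embedding_LEpo[OF inj])
  have "\<exists>!t. t \<in> on_obj (h Y) X \<and> (\<forall>f\<in>S. fn (on_arr (h Y) f) t = s f)"
    if X: "X \<in> Obj Epo" and cov: "S \<in> open_dicover_topology X" and s: "matching_family Epo (h Y) S s"
    for X S s
  proof -
    have X': "local_epo_space X" by (rule Obj_Epo_local_epo_space[OF X])
    obtain K where K: "K \<in> open_dicovers X" "K \<subseteq> S"
      using cov by (auto simp: open_dicover_topology_def topology_of_basis_def)
    then obtain T R \<U> where *: "X = of_epo T R \<and> (\<forall>W\<in>\<U>. openin T W) \<and> \<Union>\<U> = topspace T \<and>
        K = (\<lambda>W. Arrow (open_sub T R W) (\<lambda>x\<in>W. x) X) ` \<U>"
      unfolding open_dicovers_def mem_Collect_eq by (elim exE)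
    note XT = *[THEN conjunct1] and cover = *[THEN conjunct2, THEN conjunct2, THEN conjunct1]
      and K_eq = *[THEN conjunct2, THEN conjunct2, THEN conjunct2]
    have op: "openin T W" if "W \<in> \<U>" for W
      using * that by (elim conjE) (erule bspec)
    have incl: "Arrow (open_sub T R W) (\<lambda>x\<in>W. x) X \<in> S" if "W \<in> \<U>" for W
      using K(2) that by (auto simp: K_eq)
    \<comment> \<open>The sieve consists of arrows of \<open>Epo\<close>. As it contains the
      inclusions of the cover members, the spaces \<open>open_sub T R W\<close> are objects of
      \<open>Epo\<close>.\<close>
    have sieve: "f \<in> Hom Epo (src f) X" "g \<in> Hom Epo U (src f) \<Longrightarrow> Comp LEpo f g \<in> S"
      if "f \<in> S" for f g U
      using cov that
      by (auto simp: open_dicover_topology_def topology_of_basis_def sieve_def in_Hom_iff)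
    define \<sigma> where "\<sigma> f = inv_into (Arr LEpo) \<phi> (s f)" for f
    have \<sigma>: "\<sigma> f \<in> Hom LEpo (src f) Y" "s f = \<phi> (\<sigma> f)" if "f \<in> S" for f
    proof -
      have "src f \<in> Obj Epo" using sieve(1)[OF that] by (simp only: in_Hom_Epo)
      moreover have "s f \<in> on_obj (h Y) (src f)"
        using s that by (simp add: matching_family_def)
      ultimately have "s f \<in> \<phi> ` Hom LEpo (src f) Y"
        by (simp only: on_obj_hom_presheaf)
      then show "\<sigma> f \<in> Hom LEpo (src f) Y" "s f = \<phi> (\<sigma> f)" by (auto simp: \<sigma>_def)
    qed
    have \<sigma>_nat: "\<sigma> (Comp LEpo f g) = Comp LEpo (\<sigma> f) g" if f: "f \<in> S" and g: "g \<in> Hom Epo U (src f)" for f g U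
    proof -
      have g': "g \<in> Hom LEpo U (src f)" "src g = U" using g by (auto simp: in_Hom_Epo in_Hom_LEpo)
      have "fn (on_arr (h Y) g) (s f) = s (Comp LEpo f g)"
        using s f g by (auto simp: matching_family_def in_Hom_iff)
      then have "\<phi> (Comp LEpo (\<sigma> f) g) = \<phi> (\<sigma> (Comp LEpo f g))"
        by (simp only: \<sigma>(2)[OF f] \<sigma>(2)[OF sieve(2)[OF f g]] on_arr_hom_presheaf[OF g \<sigma>(1)[OF f]])
      then show ?thesis
        using encode_eq_iff Comp_LEpo_in_Hom[OF g'(1) \<sigma>(1)[OF f]] \<sigma>(1)[OF sieve(2)[OF f g]] by metis
    qed
    have pt: "point_at U u \<in> Hom Epo point_space U"
      if "U \<in> Obj Epo" "u \<in> topspace (space_of U)" for U u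
      using that point_at_in_Hom[OF Obj_Epo_local_epo_space] by (simp add: in_Hom_Epo point_space_in_Obj_Epo)
    define t where "t x = fn (\<sigma> (point_at X x)) undefined" for x
    have t: "fn (\<sigma> f) u = t (fn f u)" if f: "f \<in> S" and u: "u \<in> topspace (space_of (src f))" for f u
    proof -
      have U: "src f \<in> Obj Epo" "f \<in> Hom LEpo (src f) X"
        using sieve(1)[OF f] by (simp_all add: in_Hom_Epo)
      have "\<sigma> (point_at X (fn f u)) = point_at Y (fn (\<sigma> f) u)"
        using \<sigma>_nat[OF f pt[OF U(1) u]]
        by (simp only: Comp_point_at[OF U(2) u] Comp_point_at[OF \<sigma>(1)[OF f] u])
      then show ?thesis by (simp add: t_def)
    qed
    have Wtop: "topspace (space_of (open_sub T R W)) = W" if "W \<in> \<U>" for W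
      using openin_subset[OF op[OF that]] by (auto simp: open_sub_def)
    \<comment> \<open>A point of \<open>X\<close> lies in some \<open>W\<close> of the cover and
      hence factors through its inclusion, which belongs to the sieve.\<close>
    have pt_S: "point_at X x \<in> S" if x: "x \<in> topspace T" for x
    proof -
      obtain W where W: "W \<in> \<U>" "x \<in> W" using cover x by blast
      let ?i = "Arrow (open_sub T R W) (\<lambda>x\<in>W. x) X"
      have i: "?i \<in> Hom LEpo (open_sub T R W) X" "open_sub T R W \<in> Obj Epo"
        using sieve(1)[OF incl[OF W(1)]] by (simp_all add: in_Hom_Epo)
      have x: "x \<in> topspace (space_of (open_sub T R W))" using Wtop W by simp
      show ?thesis
        using sieve(2)[OF incl[OF W(1)], of "point_at (open_sub T R W) x" point_space] pt[OF i(2) x] W(2)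
        by (simp add: Comp_point_at[OF i(1) x])
    qed
    \<comment> \<open>On each cover member \<open>t\<close> agrees with the arrow that the matching
      family assigns to its inclusion, and that arrow is a dimap.\<close>
    have "dimap X Y t"
    proof (rule dimap_glue[OF X' Y, where \<C> = "(\<lambda>W. (W, restrict_order R W)) ` \<U>"])
      fix W Q assume "(W, Q) \<in> (\<lambda>W. (W, restrict_order R W)) ` \<U>"
      then have W: "W \<in> \<U>" "Q = restrict_order R W" by auto
      let ?i = "Arrow (open_sub T R W) (\<lambda>x\<in>W. x) X"
      have sub: "of_epo (subtopology (space_of X) W) Q = open_sub T R W"
        by (simp add: XT open_sub_def W(2))
      have W': "local_epo_space (open_sub T R W)"
        using sieve(1)[OF incl[OF W(1)]] by (simp add: in_Hom_LEpo in_Hom_Epo)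
      then show "local_epo_space (of_epo (subtopology (space_of X) W) Q)" by (simp only: sub)
      show "dimap (of_epo (subtopology (space_of X) W) Q) Y t"
        unfolding sub
      proof (rule dimap_cong[OF W' Y])
        show "dimap (open_sub T R W) Y (fn (\<sigma> ?i))"
          using \<sigma>(1)[OF incl[OF W(1)]] by (simp add: in_Hom_LEpo)
        show "fn (\<sigma> ?i) x = t x" if "x \<in> topspace (space_of (open_sub T R W))" for x
          using t[OF incl[OF W(1)], of x] that Wtop[OF W(1)] by simp
      qed
      show "openin (space_of X) W" using op[OF W(1)] by (simp add: XT)
      show "compatible_charts (V, P) (W, Q)" if "(V, P) \<in> atlas X" for V P
        using that W openin_subset[OF op[OF W(1)]]
        by (auto simp: XT compatible_charts_def restrict_order_def)
    qed (use cover in \<open>auto simp: XT\<close>)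
    from restrict_in_Hom_LEpo[OF X' Y this]
    have t_Hom: "Arrow X (restrict t (topspace (space_of X))) Y \<in> Hom LEpo X Y" (is "?t \<in> _") .
    show ?thesis
    proof (rule ex1I[of _ "\<phi> ?t"], intro conjI ballI)
      show "\<phi> ?t \<in> on_obj (h Y) X" using t_Hom by (simp add: on_obj_hom_presheaf[OF X])
      fix f assume f: "f \<in> S"
      then have f': "f \<in> Hom LEpo (src f) X" using sieve(1)[OF f] by (simp add: in_Hom_Epo)
      have "Comp LEpo ?t f = \<sigma> f"
        by (rule LEpo_arrow_eqI[OF Comp_LEpo_in_Hom[OF f' t_Hom] \<sigma>(1)[OF f]])
          (simp add: Comp_LEpo_apply[OF f'] t[OF f] Hom_LEpo_in_topspace[OF f'])
      then show "fn (on_arr (h Y) f) (\<phi> ?t) = s f"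
        by (simp only: on_arr_hom_presheaf[OF sieve(1)[OF f] t_Hom] \<sigma>(2)[OF f])
    next
      fix t' assume "t' \<in> on_obj (h Y) X \<and> (\<forall>f\<in>S. fn (on_arr (h Y) f) t' = s f)"
      then obtain g where g: "g \<in> Hom LEpo X Y" "t' = \<phi> g"
        and gS: "\<And>f. f \<in> S \<Longrightarrow> fn (on_arr (h Y) f) (\<phi> g) = s f"
        by (auto simp: on_obj_hom_presheaf[OF X])
      \<comment> \<open>The points of \<open>X\<close> belong to the sieve, so every amalgamation
        has its values there dictated by the family.\<close>
      have "g = ?t"
      proof (rule LEpo_arrow_eqI[OF g(1) t_Hom])
        fix x assume x: "x \<in> topspace (space_of X)"
        then have f: "point_at X x \<in> S" using pt_S by (simp add: XT)
        note px = point_at_in_Hom[OF X' x]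
        have src: "src (point_at X x) = point_space" by (simp add: point_at_def)
        have "\<phi> (Comp LEpo g (point_at X x)) = \<phi> (\<sigma> (point_at X x))"
          using gS[OF f] by (simp only: on_arr_hom_presheaf[OF pt[OF X x] g(1)] \<sigma>(2)[OF f])
        then have "Comp LEpo g (point_at X x) = \<sigma> (point_at X x)"
          using encode_eq_iff Comp_LEpo_in_Hom[OF px g(1)] \<sigma>(1)[OF f] by blast
        then have "fn g x = t x" by (simp add: t_def Comp_point_at[OF g(1) x, symmetric])
            (metis Comp_point_at[OF g(1) x] fn_point_at)
        then show "fn g x = fn ?t x" using x by simp
      qed
      then show "t' = \<phi> ?t" by (simp add: g(2))
    qed
  qed
  then show ?thesis
    using hom_presheaf_in_Psh[of Y] Y unfolding is_sheaf_def by simp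
qed

text \<open>The identity on arrows is one possible \<open>\<phi>\<close>. The types of
  \<open>J\<close> are independent of the others, so the shape of the diagrams is
  unrestricted.\<close>

theorem theorem1:
  fixes \<phi> :: "'a dimap_arrow \<Rightarrow> 'v"
    and J :: "('j, 'k) cat"
  assumes "inj_on \<phi> (Arr LEpo)"
  shows "is_functor LEpo (Psh Epo) (restricted_yoneda LEpo Epo \<phi>) \<and>
    fully_faithful LEpo (Psh Epo) (restricted_yoneda LEpo Epo \<phi>) \<and>
    preserves_limits J LEpo (Psh Epo) (restricted_yoneda LEpo Epo \<phi>) \<and>
    preserves_monos LEpo (Psh Epo) (restricted_yoneda LEpo Epo \<phi>) \<and>
    (\<forall>X\<in>Obj LEpo. is_sheaf Epo open_dicover_topology (on_obj (restricted_yoneda LEpo Epo \<phi>) X))"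
proof -
  interpret restricted_yoneda_embedding LEpo Epo epo_objects \<phi>
    by (rule restricted_yoneda_embedding_LEpo[OF assms])
  show ?thesis
    using is_functor_restricted_yoneda fully_faithful_restricted_yoneda_Epo[OF assms]
      preserves_limits_restricted_yoneda preserves_monos_restricted_yoneda
      is_sheaf_hom_presheaf_Epo[OF assms]
    by (simp add: on_obj_restricted_yoneda)
qed

end
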